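(* Let $L(\partial_t,\partial_x)=\partial_t^m+\sum_{j=0}^{m-1}P_j(\partial_x)\partial_t^j$ on $[0,\infty)\times\mathbb{R}^n$, where $m\ge 1$ is an integer and $P_j(\partial_x)=\sum_{|\alpha|=0}^{d_j}c_{j,\alpha}\partial_x^\alpha$ with $d_j\in\mathbb{N}$, $c_{j,\alpha}\in\mathbb{R}$, and let $\ell\in\{0,\dots,m-1\}$. Let $p_c$ be the exponent associated with $(L,\ell,n)$ defined in the context, and suppose $p_c\in(1,\infty)$. Let $\mu:[0,\infty)\to[0,\infty)$ be such that (i) $\mu$ is non-decreasing; (ii) $\mu$ is bounded on $[0,\bar\varepsilon]$ for some $\bar\varepsilon>0$; (iii) the function $F:\mathbb{R}\to\mathbb{R}$, $F(s)=|s|^{p_c}\mu(|s|)$, is convex. Let $I=\{j\in\{\ell,\dots,m-1\}: c_{j+1,0}\neq 0\}$ (with $c_{m,0}=1$). Assume that $u_j=0$ for any $j\le \ell-1$, that $u_j\in L^1(\mathbb{R}^n)$ for any $j=\ell,\dots,m-1$, and that $$\sum_{j\in I}c_{j+1,0}\int_{\mathbb{R}^n}u_j(x)\,dx>0 .$$ If there exists a global-in-time weak solution $u\in W^{\ell,p_c}_{\mathrm{loc}}\big([0,\infty),L^{p_c}_{\mathrm{loc}}(\mathbb{R}^n)\big)$ (in the sense defined in the context, with $T=\infty$) to the Cauchy problem $$L(\partial_t,\partial_x)u=F(\partial_t^\ell u)\ \ (t>0,\ x\in\mathbb{R}^n),\qquad \partial_t^ju(0,x)=u_j(x),\ \ j=0,\dots,m-1,$$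 then $$\int_0^{c_0}\frac{\mu(s)}{s}\,ds<\infty$$ for some sufficiently small $c_0>0$.
   Context: Conventions: $d_m=0$, $P_m(\partial_x)=1$ (so $c_{m,0}=1$). Exponent $p_c$. Let $J=\{j\in\{0,\dots,m\}:P_j(\partial_x)\ne0\}$ and, for $j\in J$, $r_j=\min\{|\alpha|:c_{j,\alpha}\neq0\}$. For $\eta\in[0,\infty]$ put $$g(\eta)=\min_{j\in J}\{(j-\ell)\eta+r_j\},\qquad h(\eta)=1+\frac{g(\eta)}{(n+\eta-g(\eta))_+},$$ where $a_+=\max(a,0)$ and $1/0=\infty$. Then $p_c:=\max_{\eta\in[0,\infty]}h(\eta)$. (When $p_c\in(1,\infty)$, the maximum is attained at some $\bar\eta\in(0,\infty)$.) Weak solution. Assume $u_j=0$ for $j=0,\dots,\ell-1$ and $u_j\in L^1_{\mathrm{loc}}(\mathbb{R}^n)$ for $j\ge\ell$. Let $T\in(0,\infty]$. A function $u\in W^{\ell,p_c}_{\mathrm{loc}}([0,T),L^{p_c}_{\mathrm{loc}}(\mathbb{R}^n))$ is a weak solution to the Cauchy problem if it satisfies the initial conditions $\partial_t^ju(0,\cdot)=u_j$ for every $j\in\{0,\dots,m-1\}$ and, for any $\psi\in C_c^\infty([0,T)\times\mathbb{R}^n)$ with $\psi\equiv1$ in a neighborhood of $0$, $$\int_0^T\!\!\int_{\mathbb{R}^n}F(\partial_t^\ell u)\,\psi\,dx\,dt=\sum_{j=0}^m(-1)^{j-\ell}\int_0^T\!\!\int_{\mathbb{R}^n}\partial_t^\ell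 u\;\tilde P_j(\partial_x)\partial_t^{(j-\ell)}\psi\,dx\,dt-\sum_{j=\ell}^{m-1}\int_{\mathbb{R}^n}u_j(x)\,\tilde P_{j+1}(\partial_x)\psi(0,x)\,dx .$$ Here, for $j<0$, $\partial_t^{(j)}\psi$ is defined recursively as the primitive $\partial_t^{(j)}\psi(t,x)=-\int_t^T\partial_t^{(j+1)}\psi(\tau,x)\,d\tau$ (with $\partial_t^{(0)}\psi=\psi$, and $\partial_t^{(j)}=\partial_t^j$ for $j\ge 0$), and $\tilde P_j(\partial_x)=\sum_{|\alpha|=0}^{d_j}(-1)^{|\alpha|}c_{j,\alpha}\partial_x^\alpha$. *)

theory Defs
  imports "HOL-Analysis.Analysis"
begin

section \<open>Partial derivatives and test functions\<close>

definition partial_deriv :: "'a::euclidean_space \<Rightarrow> ('a \<Rightarrow> real) \<Rightarrow> 'a \<Rightarrow> real" where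
  "partial_deriv b f = (\<lambda>x. frechet_derivative f (at x) b)"

definition smooth :: "('a::euclidean_space \<Rightarrow> real) \<Rightarrow> bool" where
  "smooth f \<longleftrightarrow>
     (\<forall>bs. set bs \<subseteq> Basis \<longrightarrow> foldr partial_deriv bs f differentiable_on UNIV)"

definition supp :: "('a::euclidean_space \<Rightarrow> real) \<Rightarrow> 'a set" where
  "supp f = closure {x. f x \<noteq> 0}"

text \<open>Multi-indices are functions \<open>'n \<Rightarrow> nat\<close>. The derivative of order \<open>\<alpha>\<close> is iterated along a list of
  directions in which direction \<open>i\<close> occurs \<open>\<alpha> i\<close> times; for smooth functions it does not depend
  on the order of the list.\<close>

definition mi_order :: "('n::finite \<Rightarrow> nat) \<Rightarrow> nat" where
  "mi_order \<alpha> = (\<Sum>i\<in>UNIV. \<alpha> i)"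

definition mi_deriv :: "('n::finite \<Rightarrow> nat) \<Rightarrow> (real^'n \<Rightarrow> real) \<Rightarrow> real^'n \<Rightarrow> real" where
  "mi_deriv \<alpha> f =
     foldr partial_deriv (map (\<lambda>i. axis i 1) (SOME is. \<forall>i. count_list is i = \<alpha> i)) f"

definition time_interval :: "ereal \<Rightarrow> real set" where
  "time_interval T = {t. 0 \<le> t \<and> ereal t < T}"

definition cylinder :: "ereal \<Rightarrow> (real \<times> (real^'n::finite)) set" where
  "cylinder T = time_interval T \<times> UNIV"

text \<open>\<open>C\<^sub>c\<^sup>\<infinity>([0,T) \<times> \<real>\<^sup>n)\<close>, as restrictions of functions in \<open>C\<^sub>c\<^sup>\<infinity>((-\<infinity>,T) \<times> \<real>\<^sup>n)\<close>. Only the values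
  at times \<open>t \<ge> 0\<close> enter anywhere.\<close>

definition test_fun :: "ereal \<Rightarrow> (real \<times> (real^'n::finite) \<Rightarrow> real) \<Rightarrow> bool" where
  "test_fun T \<psi> \<longleftrightarrow> smooth \<psi> \<and> compact (supp \<psi>) \<and> supp \<psi> \<subseteq> {t. ereal t < T} \<times> UNIV"

definition one_near_origin :: "(real \<times> (real^'n::finite) \<Rightarrow> real) \<Rightarrow> bool" where
  "one_near_origin \<psi> \<longleftrightarrow> (\<forall>\<^sub>F z in nhds (0, 0). 0 \<le> fst z \<longrightarrow> \<psi> z = 1)"

fun time_primitive :: "ereal \<Rightarrow> nat \<Rightarrow> (real \<times> (real^'n::finite) \<Rightarrow> real) \<Rightarrow> real \<times> (real^'n) \<Rightarrow> real" where
  "time_primitive T 0 \<psi> (t, x) = \<psi> (t, x)"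
| "time_primitive T (Suc k) \<psi> (t, x) =
     - (LBINT \<tau>:{\<tau>. t \<le> \<tau> \<and> ereal \<tau> < T}. time_primitive T k \<psi> (\<tau>, x))"

text \<open>\<open>\<partial>\<^sub>t\<^sup>(\<^sup>k\<^sup>)\<psi>\<close> for an integer order \<open>k\<close>: the iterated primitive for \<open>k < 0\<close>.\<close>

definition time_deriv :: "ereal \<Rightarrow> int \<Rightarrow> (real \<times> (real^'n::finite) \<Rightarrow> real) \<Rightarrow> real \<times> (real^'n) \<Rightarrow> real" where
  "time_deriv T k \<psi> = (\<lambda>(t, x).
     if 0 \<le> k then (deriv ^^ nat k) (\<lambda>s. \<psi> (s, x)) t
     else time_primitive T (nat (- k)) \<psi> (t, x))"


section \<open>The operator and the critical exponent\<close>

text \<open>\<open>L = \<Sum>\<^sub>j\<^sub>\<le>\<^sub>m P\<^sub>j(\<partial>\<^sub>x) \<partial>\<^sub>t\<^sup>j\<close> is given by the degrees \<open>d j\<close> and the coefficients \<open>c j \<alpha>\<close>; only the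
  coefficients with \<open>|\<alpha>| \<le> d j\<close> belong to \<open>P\<^sub>j\<close>.\<close>

definition normalized_operator :: "nat \<Rightarrow> (nat \<Rightarrow> nat) \<Rightarrow> (nat \<Rightarrow> ('n::finite \<Rightarrow> nat) \<Rightarrow> real) \<Rightarrow> bool" where
  "normalized_operator m d c \<longleftrightarrow> d m = 0 \<and> c m (\<lambda>_. 0) = 1"

definition symbol_supp :: "(nat \<Rightarrow> nat) \<Rightarrow> (nat \<Rightarrow> ('n::finite \<Rightarrow> nat) \<Rightarrow> real) \<Rightarrow> nat \<Rightarrow> ('n \<Rightarrow> nat) set" where
  "symbol_supp d c j = {\<alpha>. mi_order \<alpha> \<le> d j \<and> c j \<alpha> \<noteq> 0}"

definition adjoint_op ::
  "(nat \<Rightarrow> nat) \<Rightarrow> (nat \<Rightarrow> ('n::finite \<Rightarrow> nat) \<Rightarrow> real) \<Rightarrow> nat \<Rightarrow> (real^'n \<Rightarrow> real) \<Rightarrow> real^'n \<Rightarrow> real" where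
  "adjoint_op d c j \<phi> x =
     (\<Sum>\<alpha> | mi_order \<alpha> \<le> d j. (- 1) ^ mi_order \<alpha> * c j \<alpha> * mi_deriv \<alpha> \<phi> x)"

definition active_orders :: "nat \<Rightarrow> (nat \<Rightarrow> nat) \<Rightarrow> (nat \<Rightarrow> ('n::finite \<Rightarrow> nat) \<Rightarrow> real) \<Rightarrow> nat set" where
  "active_orders m d c = {j. j \<le> m \<and> symbol_supp d c j \<noteq> {}}"

definition min_order :: "(nat \<Rightarrow> nat) \<Rightarrow> (nat \<Rightarrow> ('n::finite \<Rightarrow> nat) \<Rightarrow> real) \<Rightarrow> nat \<Rightarrow> nat" where
  "min_order d c j = Inf (mi_order ` symbol_supp d c j)"

definition crit_g ::
  "nat \<Rightarrow> (nat \<Rightarrow> nat) \<Rightarrow> (nat \<Rightarrow> ('n::finite \<Rightarrow> nat) \<Rightarrow> real) \<Rightarrow> nat \<Rightarrow> real \<Rightarrow> real" where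
  "crit_g m d c l \<eta> =
     Min ((\<lambda>j. (real j - real l) * \<eta> + real (min_order d c j)) ` active_orders m d c)"

text \<open>Where the denominator vanishes, \<open>g(\<eta>) \<ge> n + \<eta> > 0\<close>, and division by zero in \<^typ>\<open>ereal\<close> gives
  the value \<open>\<infinity>\<close> (convention \<open>1/0 = \<infinity>\<close>).\<close>

definition crit_h_finite ::
  "nat \<Rightarrow> (nat \<Rightarrow> nat) \<Rightarrow> (nat \<Rightarrow> ('n::finite \<Rightarrow> nat) \<Rightarrow> real) \<Rightarrow> nat \<Rightarrow> real \<Rightarrow> ereal" where
  "crit_h_finite m d c l \<eta> =
     1 + ereal (crit_g m d c l \<eta>) / ereal (max 0 (real CARD('n) + \<eta> - crit_g m d c l \<eta>))"

text \<open>At \<open>\<eta> = \<infinity>\<close> the formula for \<open>h\<close> is an indeterminate expression such as \<open>\<infinity>/(\<infinity> - \<infinity>)\<close>, so \<open>h(\<infinity>)\<close> is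
  the limit of \<open>h\<close>. This makes \<open>h\<close> continuous on the compact interval \<open>[0,\<infinity>]\<close>, and the supremum
  below is a maximum.\<close>

definition crit_h ::
  "nat \<Rightarrow> (nat \<Rightarrow> nat) \<Rightarrow> (nat \<Rightarrow> ('n::finite \<Rightarrow> nat) \<Rightarrow> real) \<Rightarrow> nat \<Rightarrow> ereal \<Rightarrow> ereal" where
  "crit_h m d c l \<eta> =
     (if \<eta> = \<infinity> then Lim at_top (crit_h_finite m d c l)
      else crit_h_finite m d c l (real_of_ereal \<eta>))"

definition crit_exponent ::
  "nat \<Rightarrow> (nat \<Rightarrow> nat) \<Rightarrow> (nat \<Rightarrow> ('n::finite \<Rightarrow> nat) \<Rightarrow> real) \<Rightarrow> nat \<Rightarrow> ereal" where
  "crit_exponent m d c l = (SUP \<eta>\<in>{0..\<infinity>}. crit_h m d c l \<eta>)"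


section \<open>Weak solutions\<close>

definition Lp_loc :: "'a::euclidean_space set \<Rightarrow> real \<Rightarrow> ('a \<Rightarrow> real) \<Rightarrow> bool" where
  "Lp_loc S p f \<longleftrightarrow> set_borel_measurable lborel S f \<and>
     (\<forall>K. compact K \<and> K \<subseteq> S \<longrightarrow> set_integrable lborel K (\<lambda>z. \<bar>f z\<bar> powr p))"

text \<open>\<open>w\<close> is the weak derivative \<open>\<partial>\<^sub>t\<^sup>k u\<close> on \<open>(0,T)\<close> of \<open>u\<close>, viewed as a function of time with values in
  functions of \<open>x\<close>: for each scalar test function \<open>\<phi>\<close>, the identity
  \<open>\<integral> u(t) \<phi>\<^sup>(\<^sup>k\<^sup>)(t) dt = (-1)\<^sup>k \<integral> w(t) \<phi>(t) dt\<close> between functions of \<open>x\<close> holds almost everywhere.\<close>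

definition weak_time_deriv ::
  "ereal \<Rightarrow> nat \<Rightarrow> (real \<times> (real^'n::finite) \<Rightarrow> real) \<Rightarrow> (real \<times> (real^'n) \<Rightarrow> real) \<Rightarrow> bool" where
  "weak_time_deriv T k u w \<longleftrightarrow>
     (\<forall>\<phi>::real \<Rightarrow> real. smooth \<phi> \<and> compact (supp \<phi>) \<and> supp \<phi> \<subseteq> {t. 0 < t \<and> ereal t < T} \<longrightarrow>
       (AE x in lborel.
          (LBINT t:time_interval T. u (t, x) * (deriv ^^ k) \<phi> t) =
          (- 1) ^ k * (LBINT t:time_interval T. w (t, x) * \<phi> t)))"

text \<open>\<open>W\<^sup>l\<^sup>,\<^sup>p\<^sub>l\<^sub>o\<^sub>c([0,T), L\<^sup>p\<^sub>l\<^sub>o\<^sub>c(\<real>\<^sup>n))\<close>, where by Fubini \<open>L\<^sup>p\<^sub>l\<^sub>o\<^sub>c([0,T), L\<^sup>p\<^sub>l\<^sub>o\<^sub>c(\<real>\<^sup>n))\<close> is identified with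
  \<open>L\<^sup>p\<^sub>l\<^sub>o\<^sub>c([0,T) \<times> \<real>\<^sup>n)\<close>.\<close>

definition Sobolev_time_loc ::
  "ereal \<Rightarrow> nat \<Rightarrow> real \<Rightarrow> (real \<times> (real^'n::finite) \<Rightarrow> real) \<Rightarrow> bool" where
  "Sobolev_time_loc T l p u \<longleftrightarrow> Lp_loc (cylinder T) p u \<and>
     (\<forall>k\<le>l. \<exists>w. Lp_loc (cylinder T) p w \<and> weak_time_deriv T k u w)"

text \<open>\<open>w(0,\<cdot>) = f\<close>, where \<open>w(0,\<cdot>)\<close> is the value at time \<open>0\<close> of the representative of \<open>w\<close> in
  \<open>C([0,T), L\<^sup>p\<^sub>l\<^sub>o\<^sub>c(\<real>\<^sup>n))\<close>.\<close>

definition initial_value ::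
  "ereal \<Rightarrow> real \<Rightarrow> (real \<times> (real^'n::finite) \<Rightarrow> real) \<Rightarrow> (real^'n \<Rightarrow> real) \<Rightarrow> bool" where
  "initial_value T p w f \<longleftrightarrow> (\<exists>v::real \<Rightarrow> real^'n \<Rightarrow> real.
     (AE t in lborel. t \<in> time_interval T \<longrightarrow> (AE x in lborel. v t x = w (t, x))) \<and>
     (\<forall>t\<in>time_interval T. Lp_loc UNIV p (v t)) \<and>
     (\<forall>s\<in>time_interval T. \<forall>R.
        ((\<lambda>t. LBINT x:cball 0 R. \<bar>v t x - v s x\<bar> powr p) \<longlongrightarrow> 0) (at s within time_interval T)) \<and>
     (AE x in lborel. v 0 x = f x))"

text \<open>The integral identity; \<open>w\<close> stands for \<open>\<partial>\<^sub>t\<^sup>l u\<close>. Convergence of the integral of \<open>F(w) \<psi>\<close> has to be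
  required, as \<open>F(w)\<close> need not be locally integrable for \<open>w\<close> in \<open>L\<^sup>p\<^sub>l\<^sub>o\<^sub>c\<close> and the Bochner integral
  of a non-integrable function is \<open>0\<close>.\<close>

definition weak_identity ::
  "ereal \<Rightarrow> nat \<Rightarrow> (nat \<Rightarrow> nat) \<Rightarrow> (nat \<Rightarrow> ('n::finite \<Rightarrow> nat) \<Rightarrow> real) \<Rightarrow> nat \<Rightarrow> (real \<Rightarrow> real) \<Rightarrow>
   (nat \<Rightarrow> real^'n \<Rightarrow> real) \<Rightarrow> (real \<times> (real^'n) \<Rightarrow> real) \<Rightarrow> (real \<times> (real^'n) \<Rightarrow> real) \<Rightarrow> bool" where
  "weak_identity T m d c l F u0 w \<psi> \<longleftrightarrow>
     set_integrable lborel (cylinder T) (\<lambda>z. F (w z) * \<psi> z) \<and>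
     (LBINT z:cylinder T. F (w z) * \<psi> z) =
       (\<Sum>j=0..m. (- 1) powi (int j - int l) *
          (LBINT z:cylinder T.
             w z * adjoint_op d c j (\<lambda>y. time_deriv T (int j - int l) \<psi> (fst z, y)) (snd z)))
       - (\<Sum>j=l..<m. LBINT x. u0 j x * adjoint_op d c (j + 1) (\<lambda>y. \<psi> (0, y)) x)"

text \<open>Functions in \<open>W\<^sup>l\<^sup>,\<^sup>p\<^sub>l\<^sub>o\<^sub>c\<close> have traces at \<open>t = 0\<close> of the derivatives of order \<open>j < l\<close> only. The
  initial conditions of order \<open>l \<le> j < m\<close> are imposed through the last sum of the integral identity.\<close>

definition weak_solution ::
  "ereal \<Rightarrow> nat \<Rightarrow> (nat \<Rightarrow> nat) \<Rightarrow> (nat \<Rightarrow> ('n::finite \<Rightarrow> nat) \<Rightarrow> real) \<Rightarrow> nat \<Rightarrow> real \<Rightarrow> (real \<Rightarrow> real) \<Rightarrow>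
   (nat \<Rightarrow> real^'n \<Rightarrow> real) \<Rightarrow> (real \<times> (real^'n) \<Rightarrow> real) \<Rightarrow> bool" where
  "weak_solution T m d c l p F u0 u \<longleftrightarrow>
     Sobolev_time_loc T l p u \<and>
     (\<forall>j<l. \<exists>w. Lp_loc (cylinder T) p w \<and> weak_time_deriv T j u w \<and> initial_value T p w (u0 j)) \<and>
     (\<exists>w. Lp_loc (cylinder T) p w \<and> weak_time_deriv T l u w \<and>
        (\<forall>\<psi>. test_fun T \<psi> \<and> one_near_origin \<psi> \<longrightarrow> weak_identity T m d c l F u0 w \<psi>))"

end

(*
  Let eta maximise h, let g = g(eta) and kappa = n + eta - g, so that p_c * kappa = n + eta. The test
  functions psi_R are products of one-dimensional cutoffs X(t / R^eta) and X(x_i / R), where X is a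
  high power of a cutoff, so that |X^(k)| <= K X^(1/p_c). Writing theta_R for psi_R restricted to the
  complement of the box where both |t| < R^eta and |x_i| < R, the weak identity gives
      delta + int F(w) psi_R  <=  C R^(-g) int |w| theta_R^(1/p_c).
  Comparing |w| theta_R^(1/p_c) with its mean value over the support of psi_R, which has volume of
  order R^(n + eta), turns this into
      c b(R)^p_c mu(c' R^(-kappa))  <=  int F(w) theta_R,   b(R) = delta + int F(w) psi_R.
  Along R_k = r^k with r large, the right-hand side is at most min (b_k) (b_(k+1) - b_(k-1)), and this
  forces the series of mu(c' R_k^(-kappa)) to converge: its terms are bounded by differences of
  b^(1 - p_c). The series dominates the Dini integral.
*)
theory Submission
  imports Defs
begin

section \<open>Smooth functions of one variable and cutoffs\<close>

text \<open>The maximiser \<open>\<eta>\<close> is used through three facts.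
  \<open>p_c * \<kappa> = n + \<eta>\<close> is criticality: the comparison level \<open>s\<close>
  has order b(R) R^(-\<kappa>), so s^p_c times a volume of order R^(n + \<eta>) is b(R)^p_c, with no
  power of R left over. \<open>\<kappa> > 0\<close> makes the arguments of \<mu> along R_k a
  geometric sequence tending to 0, the natural partition for the Dini integral. \<open>g > 0\<close>
  makes every term on the right vanish in the inner box, although time primitives of psi_R do not
  vanish there. The number \<delta> is half of the positive sum in the hypothesis on the data: as R
  grows, only zero-order coefficients survive in the data terms, which tend to that sum. The root
  1/p_c is dictated by (|w| \<theta>^(1/p_c))^p_c = |w|^p_c \<theta>, which recovers F(w) \<theta>.
  Localisation to \<theta> turns one-scale bounds into bounds on increments of b, since each shell
  avoids the earlier supports. The product form reduces multi-index derivatives to one-variable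
  ones.\<close>

definition smooth_line :: "(real \<Rightarrow> real) \<Rightarrow> bool" where
  "smooth_line f \<longleftrightarrow>
     (\<forall>k x. ((deriv ^^ k) f has_real_derivative (deriv ^^ Suc k) f x) (at x))"

text \<open>Smoothness is the largest class of functions closed under differentiation, so exhibiting
  one closed class containing \<open>f\<close> replaces an induction on the order of the
  derivative.\<close>

lemma smooth_line_coinduct:
  assumes "S f"
    and step: "\<And>f. S f \<Longrightarrow> \<exists>f'. S f' \<and> (\<forall>x. (f has_real_derivative f' x) (at x))"
  shows "smooth_line f"
proof -
  have deriv_S: "S (deriv h) \<and> (\<forall>x. (h has_real_derivative deriv h x) (at x))" if "S h" for h
  proof -
    obtain h' where h': "S h'" "\<And>x. (h has_real_derivative h' x) (at x)"
      using step[OF \<open>S h\<close>] by blast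
    then have "deriv h = h'" by (auto intro: DERIV_imp_deriv)
    with h' show ?thesis by simp
  qed
  have "S ((deriv ^^ k) f)" for k
    by (induction k) (use assms(1) deriv_S in auto)
  then show ?thesis using deriv_S by (simp add: smooth_line_def)
qed

lemma smooth_line_has_deriv:
  "smooth_line f \<Longrightarrow> ((deriv ^^ k) f has_real_derivative (deriv ^^ Suc k) f x) (at x)"
  by (simp add: smooth_line_def)

lemma smooth_line_has_deriv_0: "smooth_line f \<Longrightarrow> (f has_real_derivative deriv f x) (at x)"
  using smooth_line_has_deriv[of f 0] by simp

lemma smooth_line_deriv: "smooth_line f \<Longrightarrow> smooth_line (deriv f)"
  unfolding smooth_line_def
proof (intro allI)
  fix k x assume "\<forall>k x. ((deriv ^^ k) f has_real_derivative (deriv ^^ Suc k) f x) (at x)"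
  from this[rule_format, of "Suc k" x]
  show "((deriv ^^ k) (deriv f) has_real_derivative (deriv ^^ Suc k) (deriv f) x) (at x)"
    by (simp only: funpow_Suc_right comp_apply)
qed

lemma smooth_line_primitive:
  assumes "\<And>x. (f has_real_derivative f' x) (at x)" "smooth_line f'"
  shows "smooth_line f"
proof (rule smooth_line_coinduct[where S = "\<lambda>h. h = f \<or> smooth_line h"])
  fix h assume "h = f \<or> smooth_line h"
  then show "\<exists>h'. (h' = f \<or> smooth_line h') \<and> (\<forall>x. (h has_real_derivative h' x) (at x))"
    using assms smooth_line_has_deriv_0 smooth_line_deriv by blast
qed simp

lemma smooth_line_continuous_on: "smooth_line f \<Longrightarrow> continuous_on S ((deriv ^^ k) f)"
  by (meson DERIV_isCont continuous_at_imp_continuous_on smooth_line_has_deriv)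

lemma smooth_line_const [intro]: "smooth_line (\<lambda>_. a)"
  by (rule smooth_line_coinduct[where S = "\<lambda>h. \<exists>a. h = (\<lambda>_. a)"])
     (auto intro!: exI[of _ "\<lambda>_. 0"] derivative_eq_intros)

lemma deriv_scaled:
  assumes "smooth_line f"
  shows "(deriv ^^ k) (\<lambda>x. f (a * x + b)) = (\<lambda>x. a ^ k * (deriv ^^ k) f (a * x + b))"
proof (induction k)
  case (Suc k)
  have "((\<lambda>x. a ^ k * (deriv ^^ k) f (a * x + b)) has_real_derivative
          a ^ k * ((deriv ^^ Suc k) f (a * x + b) * a)) (at x)" for x
    by (intro DERIV_cmult DERIV_chain2[OF smooth_line_has_deriv[OF assms]])
       (auto intro!: derivative_eq_intros)
  then have "deriv (\<lambda>x. a ^ k * (deriv ^^ k) f (a * x + b)) x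
               = a ^ k * ((deriv ^^ Suc k) f (a * x + b) * a)" for x
    by (rule DERIV_imp_deriv)
  then show ?case by (simp add: Suc fun_eq_iff)
qed simp

lemma smooth_line_affine:
  assumes "smooth_line f"
  shows "smooth_line (\<lambda>x. f (a * x + b))"
  unfolding smooth_line_def deriv_scaled[OF assms]
proof (intro allI)
  fix k x
  show "((\<lambda>x. a ^ k * (deriv ^^ k) f (a * x + b)) has_real_derivative
          a ^ Suc k * (deriv ^^ Suc k) f (a * x + b)) (at x)"
    by (rule DERIV_cong[OF DERIV_cmult[OF DERIV_chain2[OF smooth_line_has_deriv[OF assms]]]])
       (auto intro!: derivative_eq_intros)
qed

text \<open>Products alone are not closed under differentiation; by the Leibniz rule their finite
  sums are, which is what \<open>smooth_line_coinduct\<close> asks for.\<close>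

inductive product_span :: "(real \<Rightarrow> real) \<Rightarrow> bool" where
  mult: "smooth_line f \<Longrightarrow> smooth_line g \<Longrightarrow> product_span (\<lambda>x. f x * g x)"
| add: "product_span f \<Longrightarrow> product_span g \<Longrightarrow> product_span (\<lambda>x. f x + g x)"

lemma product_span_smooth_line: "product_span f \<Longrightarrow> smooth_line f"
proof (rule smooth_line_coinduct[where S = product_span])
  fix f assume "product_span f"
  then show "\<exists>f'. product_span f' \<and> (\<forall>x. (f has_real_derivative f' x) (at x))"
  proof induction
    case (mult f g)
    have "product_span (\<lambda>x. deriv f x * g x + f x * deriv g x)"
      by (rule product_span.add[of "\<lambda>x. deriv f x * g x" "\<lambda>x. f x * deriv g x"])
         (rule product_span.mult; use mult smooth_line_deriv in blast)+
    moreover have "((\<lambda>x. f x * g x) has_real_derivative (deriv f x * g x + f x * deriv g x)) (at x)" for x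
      using mult by (auto intro!: derivative_eq_intros smooth_line_has_deriv_0)
    ultimately show ?case by blast
  next
    case (add f g)
    then obtain f' g' where "product_span f'" "\<forall>x. (f has_real_derivative f' x) (at x)"
      "product_span g'" "\<forall>x. (g has_real_derivative g' x) (at x)" by blast
    then show ?case
      by (intro exI[of _ "\<lambda>x. f' x + g' x"]) (auto intro: product_span.add DERIV_add)
  qed
qed

lemma smooth_line_mult: "smooth_line f \<Longrightarrow> smooth_line g \<Longrightarrow> smooth_line (\<lambda>x. f x * g x)"
  by (rule product_span_smooth_line[OF product_span.mult])

lemma smooth_line_cmult: "smooth_line f \<Longrightarrow> smooth_line (\<lambda>x. a * f x)"
  by (intro smooth_line_mult smooth_line_const)

lemma smooth_line_add:
  assumes "smooth_line f" "smooth_line g" shows "smooth_line (\<lambda>x. f x + g x)"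
  using product_span.add[OF product_span.mult[OF assms(1) smooth_line_const[of 1]]
      product_span.mult[OF assms(2) smooth_line_const[of 1]]]
  by (intro product_span_smooth_line) simp

lemma smooth_line_power: "smooth_line f \<Longrightarrow> smooth_line (\<lambda>x. f x ^ k)"
  by (induction k) (auto intro: smooth_line_mult)

text \<open>Serves to show that derivatives of the cutoffs vanish in the region where the cutoffs
  equal 1. Openness of \<open>S\<close> lets the vanishing propagate from one order to the
  next.\<close>

lemma higher_deriv_locally_const:
  assumes "open S" "\<And>x. x \<in> S \<Longrightarrow> f x = (a::real)" "x \<in> S" "0 < k"
  shows "(deriv ^^ k) f x = 0"
proof -
  have "(deriv ^^ Suc i) f x = 0" if "x \<in> S" for i x
    using that
  proof (induction i arbitrary: x)
    case 0
    have "deriv f x = deriv (\<lambda>_. a) x"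
      by (rule deriv_cong_ev) (use assms(1,2) 0 eventually_nhds in blast)+
    then show ?case by simp
  next
    case (Suc i)
    have "deriv ((deriv ^^ Suc i) f) x = deriv (\<lambda>_. 0) x"
      by (rule deriv_cong_ev) (use assms(1) Suc eventually_nhds in blast)+
    then show ?case by simp
  qed
  then show ?thesis using assms(3,4) by (metis Suc_pred)
qed

section \<open>Flat functions, the smooth step and powers of cutoffs\<close>

definition flat :: "real poly \<Rightarrow> real \<Rightarrow> real" where
  "flat q x = (if x \<le> 0 then 0 else poly q (inverse x) * exp (- inverse x))"

lemma poly_exp_tendsto_0: "((\<lambda>y::real. poly q y * exp (- y)) \<longlongrightarrow> 0) at_top"
proof -
  have "((\<lambda>y::real. \<Sum>i\<le>degree q. coeff q i * (y ^ i / exp y)) \<longlongrightarrow> (\<Sum>i\<le>degree q. coeff q i * 0)) at_top"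
    by (intro tendsto_intros tendsto_power_div_exp_0)
  then show ?thesis
    by (simp add: poly_altdef exp_minus field_simps sum_distrib_left sum_divide_distrib)
qed

lemma flat_tendsto_0: "(flat q \<longlongrightarrow> 0) (at 0)"
proof -
  have "((\<lambda>x. poly q (inverse x) * exp (- inverse x)) \<longlongrightarrow> 0) (at_right (0::real))"
    using filterlim_compose[OF poly_exp_tendsto_0 filterlim_inverse_at_top_right] .
  then have "(flat q \<longlongrightarrow> 0) (at_right 0)"
    by (rule Lim_transform_eventually)
       (auto simp: flat_def eventually_at_filter)
  moreover have "(flat q \<longlongrightarrow> 0) (at_left 0)"
    by (rule Lim_transform_eventually[OF tendsto_const])
       (auto simp: flat_def eventually_at_filter)
  ultimately show ?thesis by (simp add: filterlim_at_split)
qed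

text \<open>With y = 1/x, differentiating q(y) exp(-y) in x gives y^2 (q - q')(y) exp(-y), so the
  polynomial parameter makes the family closed under differentiation. At 0 the right difference
  quotient is again flat, with polynomial y q(y).\<close>

lemma flat_has_deriv:
  "(flat q has_real_derivative flat ([:0, 0, 1:] * (q - pderiv q)) x) (at x)"
proof -
  consider "x < 0" | "x = 0" | "0 < x" by linarith
  then show ?thesis
  proof cases
    case 1
    have "((\<lambda>_. 0) has_real_derivative 0) (at x)" by simp
    then have "(flat q has_real_derivative 0) (at x)"
      by (rule has_field_derivative_transform_within_open[of _ _ _ "{..<0}"]) (use 1 in \<open>auto simp: flat_def\<close>)
    then show ?thesis using 1 by (simp add: flat_def)
  next
    case 2
    have "((\<lambda>h. (flat q (0 + h) - flat q 0) / h) \<longlongrightarrow> 0) (at 0)"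
      using flat_tendsto_0[of "[:0, 1:] * q"]
      by (rule Lim_transform_eventually) (auto simp: flat_def eventually_at_filter field_simps)
    then show ?thesis using 2 by (simp add: DERIV_def flat_def)
  next
    case 3
    have "((\<lambda>x. poly q (inverse x) * exp (- inverse x)) has_real_derivative
        flat ([:0, 0, 1:] * (q - pderiv q)) x) (at x)"
      using 3 by (auto intro!: derivative_eq_intros poly_DERIV[THEN DERIV_chain2]
          simp: flat_def field_simps power2_eq_square)
    then show ?thesis
      by (rule has_field_derivative_transform_within_open[of _ _ _ "{0<..}"]) (use 3 in \<open>auto simp: flat_def\<close>)
  qed
qed

lemma smooth_line_flat: "smooth_line (flat q)"
  by (rule smooth_line_coinduct[where S = "\<lambda>f. \<exists>q. f = flat q"]) (use flat_has_deriv in blast)+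

text \<open>One minus the normalised primitive of a nonnegative bump \<open>B\<close> that is
  positive exactly on (1, 2).\<close>

lemma smooth_step_exists:
  "\<exists>Z. smooth_line Z \<and> (\<forall>x\<le>1. Z x = 1) \<and> (\<forall>x\<ge>2. Z x = 0) \<and> antimono Z"
proof -
  define B where "B x = flat 1 (x - 1) * flat 1 (2 - x)" for x
  have B_smooth: "smooth_line B"
    using smooth_line_mult[OF smooth_line_affine[OF smooth_line_flat[of 1], of 1 "-1"]
        smooth_line_affine[OF smooth_line_flat[of 1], of "-1" 2]]
    by (simp add: B_def[abs_def] algebra_simps)
  have cont: "continuous_on S B" for S using smooth_line_continuous_on[OF B_smooth, of S 0] by simp
  have B_pos: "0 < B x" if "1 < x" "x < 2" for x using that by (simp add: B_def flat_def)
  have B_0: "B x = 0" if "x \<le> 1 \<or> 2 \<le> x" for x using that by (auto simp: B_def flat_def)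
  have B_nonneg: "0 \<le> B x" for x using B_pos[of x] B_0[of x] by force
  define G where "G x = (if x < 0 then 0 else integral {0..x} B)" for x
  have G0: "integral {0..x} B = 0" if "x \<le> 1" for x
    using B_0 that by (subst integral_cong[of _ _ "\<lambda>_. 0"]) auto
  have G_deriv: "(G has_real_derivative B x) (at x)" for x
  proof (cases "x < 1")
    case True
    have G_eq: "G y = 0" if "y < 1" for y using that G0[of y] by (simp add: G_def)
    have "((\<lambda>_. 0) has_real_derivative 0) (at x)" by simp
    then have "(G has_real_derivative 0) (at x)"
      by (rule has_field_derivative_transform_within_open[of _ _ _ "{..<1}"]) (use True G_eq in simp_all)
    then show ?thesis using B_0 True by simp
  next
    case False
    have "((\<lambda>u. integral {0..u} B) has_real_derivative B x) (at x within {0..x + 1})"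
      by (rule integral_has_real_derivative[OF cont]) (use False in auto)
    then have "((\<lambda>u. integral {0..u} B) has_real_derivative B x) (at x)"
      using False at_within_Icc_at[of 0 x "x + 1"] by simp
    then show ?thesis
      by (rule has_field_derivative_transform_within_open[of _ _ _ "{0<..}"]) (use False in \<open>auto simp: G_def\<close>)
  qed
  have G_mono: "G x \<le> G y" if "x \<le> y" for x y
    using DERIV_nonneg_imp_nondecreasing[OF that] G_deriv B_nonneg by blast
  have G_cont: "continuous_on S G" for S
    by (meson DERIV_isCont G_deriv continuous_at_imp_continuous_on)
  have "G 1 < G 2"
    by (rule DERIV_pos_imp_increasing_open[of 1 2]) (use G_deriv B_pos G_cont in auto)
  then have "0 < G 2" using G0[of 1] by (simp add: G_def)
  have G_right: "G x = G 2" if "2 \<le> x" for x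
  proof (cases "x = 2")
    case False
    have "(G has_real_derivative 0) (at y)" if "2 < y" for y
      using G_deriv[of y] B_0[of y] that by simp
    then show ?thesis
      using DERIV_isconst2[of 2 x G x] G_cont that False by simp
  qed simp
  define Z where "Z x = 1 + (- 1 / G 2) * G x" for x
  have "smooth_line Z"
    unfolding Z_def[abs_def]
    by (intro smooth_line_add smooth_line_cmult smooth_line_const
        smooth_line_primitive[OF G_deriv B_smooth])
  moreover have "Z x = 1" if "x \<le> 1" for x using G0[of x] that by (simp add: Z_def G_def)
  moreover have "Z x = 0" if "2 \<le> x" for x using G_right[OF that] \<open>0 < G 2\<close> by (simp add: Z_def)
  moreover have "antimono Z"
    using G_mono \<open>0 < G 2\<close> by (auto simp: antimono_def Z_def divide_right_mono)
  ultimately show ?thesis by blast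
qed

text \<open>Each differentiation of \<open>Y ^ N\<close> costs one factor of \<open>Y\<close>;
  everything else is collected in a smooth \<open>Z\<close> on which no further information is
  needed.\<close>

lemma higher_deriv_power_factor:
  assumes "smooth_line Y" "k \<le> N"
  shows "\<exists>Z. smooth_line Z \<and> (deriv ^^ k) (\<lambda>x. Y x ^ N) = (\<lambda>x. Y x ^ (N - k) * Z x)"
  using assms(2)
proof (induction k)
  case 0
  then show ?case by (auto intro!: exI[of _ "\<lambda>_. 1"])
next
  case (Suc k)
  then obtain Z where Z: "smooth_line Z" "(deriv ^^ k) (\<lambda>x. Y x ^ N) = (\<lambda>x. Y x ^ (N - k) * Z x)"
    by auto
  define r where "r = N - Suc k"
  have Nk: "N - k = Suc r" using Suc by (simp add: r_def)
  have "((\<lambda>x. Y x ^ (N - k) * Z x) has_real_derivative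
         Y x ^ r * (real (Suc r) * deriv Y x * Z x + Y x * deriv Z x)) (at x)" for x
    unfolding Nk
    by (rule DERIV_cong[OF DERIV_mult[OF
          DERIV_power[of Y _ _ UNIV "Suc r", OF smooth_line_has_deriv_0[OF assms(1)]]
          smooth_line_has_deriv_0[OF Z(1)]]]) (simp add: algebra_simps)
  then have "deriv (\<lambda>x. Y x ^ (N - k) * Z x) =
      (\<lambda>x. Y x ^ r * (real (Suc r) * deriv Y x * Z x + Y x * deriv Z x))"
    by (auto intro: DERIV_imp_deriv)
  moreover have "smooth_line (\<lambda>x. real (Suc r) * deriv Y x * Z x + Y x * deriv Z x)"
    by (intro smooth_line_add smooth_line_mult smooth_line_const smooth_line_deriv assms Z)
  ultimately show ?case
    using Z unfolding r_def[symmetric] funpow.simps comp_apply by (simp only: Nk) blast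
qed

text \<open>The root bound, up to order \<open>M\<close> with a common constant \<open>K\<close>,
  controls time and space derivatives. Monotonicity on the half-line controls the iterated time
  primitives that occur for \<open>j < l\<close>.\<close>

definition cutoff :: "real \<Rightarrow> nat \<Rightarrow> real \<Rightarrow> (real \<Rightarrow> real) \<Rightarrow> bool" where
  "cutoff p M K X \<longleftrightarrow> smooth_line X \<and> 1 \<le> K \<and> (\<forall>x. 0 \<le> X x \<and> X x \<le> 1) \<and>
    (\<forall>x. \<bar>x\<bar> \<le> 1 \<longrightarrow> X x = 1) \<and> (\<forall>x. 2 \<le> \<bar>x\<bar> \<longrightarrow> X x = 0) \<and> antimono_on {0..} X \<and>
    (\<forall>k\<le>M. \<forall>x. \<bar>(deriv ^^ k) X x\<bar> \<le> K * X x powr (1 / p))"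

lemma cutoffD:
  assumes "cutoff p M K X"
  shows "smooth_line X" "1 \<le> K" "0 \<le> X x" "X x \<le> 1" "\<bar>x\<bar> \<le> 1 \<Longrightarrow> X x = 1"
    "2 \<le> \<bar>x\<bar> \<Longrightarrow> X x = 0" "antimono_on {0..} X"
    "k \<le> M \<Longrightarrow> \<bar>(deriv ^^ k) X x\<bar> \<le> K * X x powr (1 / p)"
  using assms by (auto simp: cutoff_def)

text \<open>A high power of a cutoff function has derivatives controlled by a root of the function
  itself, which is what makes the right-hand side of the weak identity absorbable.\<close>

lemma cutoff_exists:
  fixes p :: real
  assumes "1 < p"
  shows "\<exists>X K. cutoff p M K X"
proof -
  obtain Z where Z: "smooth_line Z" "\<And>x. x \<le> 1 \<Longrightarrow> Z x = 1" "\<And>x. 2 \<le> x \<Longrightarrow> Z x = 0" "antimono Z"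
    using smooth_step_exists by blast
  have Z01: "0 \<le> Z x" "Z x \<le> 1" for x
    using antimonoD[OF Z(4), of x "max x 2"] antimonoD[OF Z(4), of "min x 1" x] Z(2)[of "min x 1"] Z(3)[of "max x 2"]
    by auto
  \<comment> \<open>The step times its mirror image. For x \<ge> 0 the mirrored factor is 1, so
    \<open>Y\<close> inherits the monotonicity of \<open>Z\<close> there.\<close>
  define Y where "Y x = Z x * Z (- 1 * x + 0)" for x
  have Y: "smooth_line Y"
    unfolding Y_def[abs_def] by (intro smooth_line_mult smooth_line_affine Z)
  have Y01: "0 \<le> Y x" "Y x \<le> 1" for x
    using Z01 by (auto simp: Y_def intro: mult_le_one)
  have Y1: "Y x = 1" if "\<bar>x\<bar> \<le> 1" for x using that Z(2) by (auto simp: Y_def)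
  have Y0: "Y x = 0" if "2 \<le> \<bar>x\<bar>" for x using that Z(3) by (auto simp: Y_def abs_if split: if_splits)
  have Ydec: "Y y \<le> Y x" if "0 \<le> x" "x \<le> y" for x y
    using that antimonoD[OF Z(4), of x y] Z(2)[of "-x"] Z(2)[of "-y"] by (auto simp: Y_def)
  \<comment> \<open>Chosen so that N/p \<le> N - M. As 0 \<le> Y \<le> 1, the power
    \<open>Y ^ (N - k)\<close> left after \<open>k \<le> M\<close> derivatives is then at most
    Y^(N/p) = X^(1/p).\<close>
  obtain N where N: "real M * p / (p - 1) < real N" using reals_Archimedean2 by blast
  then have "real M * p < real N * (p - 1)" using assms by (simp add: field_simps)
  then have N_root: "real N / p \<le> real N - real M" using assms by (simp add: field_simps)
  have N_pos: "0 < N" 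
  proof -
    have "0 \<le> real M * p / (p - 1)" using assms by simp
    then show ?thesis using N by (simp add: order_le_less_trans)
  qed
  have "0 < real N / p" using N_pos assms by simp
  then have NM: "M < N" using N_root by linarith
  define X where "X x = Y x ^ N" for x
  have "\<exists>C. \<forall>x. \<bar>(deriv ^^ k) X x\<bar> \<le> C * X x powr (1 / p)" if k: "k \<le> M" for k
  proof -
    obtain W where W: "smooth_line W" "(deriv ^^ k) X = (\<lambda>x. Y x ^ (N - k) * W x)"
      using higher_deriv_power_factor[OF Y, of k N] k NM unfolding X_def[abs_def] by auto
    have "bounded (W ` {-2..2})"
      using smooth_line_continuous_on[OF W(1), of _ 0] by (intro compact_imp_bounded compact_continuous_image) auto
    then obtain C where C: "\<And>x. x \<in> {-2..2} \<Longrightarrow> \<bar>W x\<bar> \<le> C"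
      unfolding bounded_iff by (metis imageI real_norm_def)
    have "\<bar>(deriv ^^ k) X x\<bar> \<le> C * X x powr (1 / p)" for x
    proof (cases "Y x = 0")
      case True
      then show ?thesis using k NM by (simp add: W X_def zero_power)
    next
      case False
      then have x: "x \<in> {-2..2}" using Y0[of x] by force
      have Yp: "0 < Y x" using False Y01[of x] by simp
      have "Y x ^ (N - k) = Y x powr real (N - k)" using Yp by (simp add: powr_realpow)
      also have "\<dots> \<le> Y x powr (real N / p)"
        using Yp Y01[of x] N_root k NM by (intro powr_mono') (auto simp: of_nat_diff)
      also have "\<dots> = X x powr (1 / p)"
        using Yp by (simp add: X_def powr_powr flip: powr_realpow)
      finally have "Y x ^ (N - k) * \<bar>W x\<bar> \<le> X x powr (1 / p) * C"
        using C[OF x] Yp by (intro mult_mono) auto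
      then show ?thesis using Yp by (simp add: W abs_mult mult.commute)
    qed
    then show ?thesis by blast
  qed
  then obtain C where C: "\<And>k x. k \<le> M \<Longrightarrow> \<bar>(deriv ^^ k) X x\<bar> \<le> C k * X x powr (1 / p)"
    by metis
  define K where "K = Max (insert 1 (C ` {..M}))"
  have K: "1 \<le> K" "\<And>k. k \<le> M \<Longrightarrow> C k \<le> K" unfolding K_def by (auto intro: Max_ge simp del: Max_insert)
  have "\<bar>(deriv ^^ k) X x\<bar> \<le> K * X x powr (1 / p)" if "k \<le> M" for k x
    using C[OF that, of x] K(2)[OF that] by (meson mult_right_mono order_trans powr_ge_zero)
  moreover have "antimono_on {0..} X"
    using Ydec Y01 by (auto simp: monotone_on_def X_def intro!: power_mono)
  moreover have "smooth_line X" unfolding X_def[abs_def] by (rule smooth_line_power[OF Y])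
  ultimately show ?thesis
    unfolding cutoff_def
    using K(1) Y01 Y1 Y0 N_pos
    by (intro exI[of _ X] exI[of _ K]) (auto simp: X_def power_le_one)
qed

section \<open>The critical scale\<close>

lemma continuous_on_Min_image:
  fixes f :: "'i \<Rightarrow> 'a::topological_space \<Rightarrow> real"
  assumes "finite J" "J \<noteq> {}" "\<And>j. j \<in> J \<Longrightarrow> continuous_on S (f j)"
  shows "continuous_on S (\<lambda>x. Min ((\<lambda>j. f j x) ` J))"
  using assms
proof (induction J rule: finite_ne_induct)
  case (insert j J)
  then have "continuous_on S (\<lambda>x. min (f j x) (Min ((\<lambda>j. f j x) ` J)))"
    by (intro continuous_on_min) auto
  with insert show ?case by simp
qed simp

lemma finite_active_orders: "finite (active_orders m d c)"
  by (rule finite_subset[of _ "{..m}"]) (auto simp: active_orders_def)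

lemma mi_order_0 [simp]: "mi_order (\<lambda>_. 0) = 0"
  by (simp add: mi_order_def)

lemma top_order_active:
  assumes "normalized_operator m d c"
  shows "m \<in> active_orders m d c" "min_order d c m = 0"
proof -
  have 0: "(\<lambda>_. 0) \<in> symbol_supp d c m"
    using assms by (simp add: symbol_supp_def normalized_operator_def)
  then show "m \<in> active_orders m d c" by (auto simp: active_orders_def)
  have "0 \<in> mi_order ` symbol_supp d c m" using 0 image_iff by fastforce
  then show "min_order d c m = 0" by (auto simp: min_order_def intro!: cInf_eq_minimum)
qed

lemma crit_g_le:
  "j \<in> active_orders m d c \<Longrightarrow>
     crit_g m d c l \<eta> \<le> (real j - real l) * \<eta> + real (min_order d c j)"
  unfolding crit_g_def by (rule Min_le) (auto intro: finite_active_orders)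

text \<open>For large \<eta> the line of smallest slope is the minimum. Slopes of distinct indices
  differ by at least 1 and intercepts are nonnegative, so the intercept of the flattest line is
  already a sufficient threshold.\<close>

lemma crit_g_eventually_affine:
  fixes d :: "nat \<Rightarrow> nat" and c :: "nat \<Rightarrow> ('n::finite \<Rightarrow> nat) \<Rightarrow> real"
  assumes "active_orders m d c \<noteq> {}"
  defines "i \<equiv> Min (active_orders m d c)"
  assumes "real (min_order d c i) \<le> \<eta>"
  shows "crit_g m d c l \<eta> = (real i - real l) * \<eta> + real (min_order d c i)"
proof -
  have i: "i \<in> active_orders m d c"
    unfolding i_def by (intro Min_in finite_active_orders assms)
  show ?thesis
    unfolding crit_g_def
  proof (rule Min_eqI)
    fix y assume "y \<in> (\<lambda>j. (real j - real l) * \<eta> + real (min_order d c j)) ` active_orders m d c"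
    then obtain j where j: "j \<in> active_orders m d c"
      and y: "y = (real j - real l) * \<eta> + real (min_order d c j)" by blast
    have "i \<le> j" unfolding i_def by (intro Min_le finite_active_orders j)
    show "(real i - real l) * \<eta> + real (min_order d c i) \<le> y"
    proof (cases "i = j")
      case False
      then have "real (Suc i) \<le> real j" using \<open>i \<le> j\<close> by (simp only: of_nat_le_iff)
      moreover have "0 \<le> \<eta>" using assms(3) of_nat_0_le_iff order_trans by blast
      ultimately have "1 * \<eta> \<le> (real j - real i) * \<eta>" by (intro mult_right_mono) auto
      then show ?thesis using assms(3) unfolding y by (simp add: algebra_simps)
    qed (simp add: y)
  qed (use i in \<open>auto intro: finite_active_orders\<close>)
qed

text \<open>The supremum defining the critical exponent is a maximum: the denominator in \<open>h\<close> is positive because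
  \<open>p\<close> is finite, and \<open>h\<close> has a limit at most \<open>1\<close> at infinity because \<open>g\<close> is eventually affine.\<close>

lemma critical_scale_exists:
  fixes d :: "nat \<Rightarrow> nat" and c :: "nat \<Rightarrow> ('n::finite \<Rightarrow> nat) \<Rightarrow> real"
  assumes norm: "normalized_operator m d c"
    and p: "crit_exponent m d c l = ereal p" "1 < p"
  obtains \<eta> where "0 < \<eta>" "0 < crit_g m d c l \<eta>" "crit_g m d c l \<eta> < real CARD('n) + \<eta>"
    "p * (real CARD('n) + \<eta> - crit_g m d c l \<eta>) = real CARD('n) + \<eta>"
proof -
  define N where "N = real CARD('n)"
  define g where "g = crit_g m d c l"
  define H where "H \<eta> = 1 + g \<eta> / (N + \<eta> - g \<eta>)" for \<eta>
  define J where "J = active_orders m d c"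
  have N: "0 < N" by (simp add: N_def)
  have J: "finite J" "m \<in> J" "J \<noteq> {}"
    using top_order_active[OF norm] finite_active_orders[of m d c] by (auto simp: J_def)
  have le_p: "crit_h m d c l \<eta> \<le> ereal p" if "0 \<le> \<eta>" for \<eta>
    unfolding p(1)[symmetric] crit_exponent_def by (rule SUP_upper) (use that in auto)
  have finite_le_p: "crit_h_finite m d c l \<eta> \<le> ereal p" if "0 \<le> \<eta>" for \<eta>
    using le_p[of "ereal \<eta>"] that by (simp add: crit_h_def)
  \<comment> \<open>Otherwise the truncated denominator is 0 while the numerator is positive, and
    \<open>h\<close> would take the value \<infinity>.\<close>
  have D: "g \<eta> < N + \<eta>" if "0 \<le> \<eta>" for \<eta>
  proof (rule ccontr)
    assume "\<not> g \<eta> < N + \<eta>"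
    then have *: "max 0 (N + \<eta> - g \<eta>) = 0" "0 < g \<eta>" using N that by auto
    have "crit_h_finite m d c l \<eta> = \<infinity>"
      unfolding crit_h_finite_def g_def[symmetric] N_def[symmetric] *(1) using *(2)
      by (simp add: divide_ereal_def)
    then show False using finite_le_p[OF that] by simp
  qed
  have h_eq: "crit_h_finite m d c l \<eta> = ereal (H \<eta>)" if "0 \<le> \<eta>" for \<eta>
    using D[OF that] unfolding crit_h_finite_def H_def g_def[symmetric] N_def[symmetric]
    by (simp add: max_def one_ereal_def)
  have H_le_p: "H \<eta> \<le> p" if "0 \<le> \<eta>" for \<eta>
    using finite_le_p[OF that] h_eq[OF that] by simp
  define i where "i = Min J"
  define r where "r = real (min_order d c i)"
  have r: "0 \<le> r" by (simp add: r_def)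
  have g_affine: "g \<eta> = (real i - real l) * \<eta> + r" if "r \<le> \<eta>" for \<eta>
    using crit_g_eventually_affine[of m d c \<eta> l] J that unfolding g_def i_def J_def r_def by simp
  \<comment> \<open>If every slope were at least 1, then g(\<eta>) \<ge> \<eta> for large \<eta>,
    the denominator would stay at most \<open>N\<close>, and \<eta> \<ge> N p would push
    \<open>H\<close> above \<open>p\<close>.\<close>
  have "i \<le> l"
  proof (rule ccontr)
    assume "\<not> i \<le> l"
    define \<eta> where "\<eta> = max r (N * p)"
    have \<eta>: "0 \<le> \<eta>" "r \<le> \<eta>" "N * p \<le> \<eta>" using r by (auto simp: \<eta>_def)
    have "1 * \<eta> \<le> (real i - real l) * \<eta>"
      using \<open>\<not> i \<le> l\<close> \<eta> by (intro mult_right_mono) auto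
    then have "\<eta> \<le> g \<eta>" using g_affine[OF \<eta>(2)] r by simp
    then have "N + \<eta> - g \<eta> \<le> N" "0 < N + \<eta> - g \<eta>" using D[OF \<eta>(1)] by auto
    moreover have "0 \<le> g \<eta>" using \<open>\<eta> \<le> g \<eta>\<close> \<eta> by simp
    ultimately have "g \<eta> / N \<le> g \<eta> / (N + \<eta> - g \<eta>)" by (intro divide_left_mono) (use N in auto)
    moreover have "p \<le> g \<eta> / N" using \<eta> \<open>\<eta> \<le> g \<eta>\<close> N by (simp add: pos_le_divide_eq mult.commute)
    ultimately show False using H_le_p[OF \<eta>(1)] by (simp add: H_def)
  qed
  define a where "a = real l - real i"
  have a: "0 \<le> a" using \<open>i \<le> l\<close> by (simp add: a_def)
  have H_lim: "(H \<longlongrightarrow> 1 + (0 - a) / (0 + (1 + a))) at_top"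
  proof -
    have "((\<lambda>\<eta>::real. 1 + (r / \<eta> - a) / ((N - r) / \<eta> + (1 + a))) \<longlongrightarrow> 1 + (0 - a) / (0 + (1 + a))) at_top"
      using a by (intro tendsto_intros tendsto_divide_0[OF tendsto_const] filterlim_at_top_imp_at_infinity filterlim_ident) auto
    moreover have "\<forall>\<^sub>F \<eta> in at_top. 1 + (r / \<eta> - a) / ((N - r) / \<eta> + (1 + a)) = H \<eta>"
      using eventually_gt_at_top[of "max r 0"]
    proof eventually_elim
      case (elim \<eta>)
      have "(r / \<eta> - a) / ((N - r) / \<eta> + (1 + a)) = ((r / \<eta> - a) * \<eta>) / (((N - r) / \<eta> + (1 + a)) * \<eta>)"
        using elim by simp
      also have "(r / \<eta> - a) * \<eta> = g \<eta>" using elim g_affine[of \<eta>] by (simp add: a_def algebra_simps)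
      also have "((N - r) / \<eta> + (1 + a)) * \<eta> = N - r + (1 + a) * \<eta>"
        using elim unfolding distrib_right by simp
      also have "\<dots> = N + \<eta> - g \<eta>" using elim g_affine[of \<eta>] by (simp add: a_def algebra_simps)
      finally show ?case by (simp add: H_def)
    qed
    ultimately show ?thesis by (rule Lim_transform_eventually)
  qed
  define L where "L = 1 + (0 - a) / (0 + (1 + a))"
  have L: "L \<le> 1" using a by (simp add: L_def)
  have "((\<lambda>\<eta>. ereal (H \<eta>)) \<longlongrightarrow> ereal L) at_top" using H_lim by (simp add: L_def)
  then have "(crit_h_finite m d c l \<longlongrightarrow> ereal L) at_top"
    by (rule Lim_transform_eventually) (use eventually_ge_at_top[of 0] in eventually_elim, simp add: h_eq)
  then have h_inf: "crit_h m d c l \<infinity> = ereal L"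
    by (simp add: crit_h_def tendsto_Lim)
  \<comment> \<open>\<open>(1 + p) / 2\<close> lies strictly between the limit at infinity and
    \<open>p\<close>. Beyond \<open>T\<close> the values stay below it, so the supremum
    \<open>p\<close> has to be the maximum over the compact interval.\<close>
  have "\<forall>\<^sub>F \<eta> in at_top. H \<eta> < (1 + p) / 2"
    by (rule order_tendstoD(2)[OF H_lim[folded L_def]]) (use L p(2) in simp)
  then obtain T0 where T0: "\<And>\<eta>. T0 \<le> \<eta> \<Longrightarrow> H \<eta> < (1 + p) / 2"
    by (auto simp: eventually_at_top_linorder)
  define T where "T = max T0 0"
  have "continuous_on {0..T} g"
    unfolding g_def crit_g_def[abs_def] J_def[symmetric]
    by (intro continuous_on_Min_image J continuous_intros)
  then have "continuous_on {0..T} H"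
    unfolding H_def using D by (intro continuous_intros) (force dest: order_less_imp_not_eq2)+
  then obtain \<eta> where \<eta>: "\<eta> \<in> {0..T}" "\<And>x. x \<in> {0..T} \<Longrightarrow> H x \<le> H \<eta>"
    using continuous_attains_sup[of "{0..T}" H] by (auto simp: T_def)
  have "crit_exponent m d c l \<le> ereal (max ((1 + p) / 2) (H \<eta>))"
    unfolding crit_exponent_def
  proof (rule SUP_least)
    fix x :: ereal assume x: "x \<in> {0..\<infinity>}"
    show "crit_h m d c l x \<le> ereal (max ((1 + p) / 2) (H \<eta>))"
    proof (cases x)
      case (real y)
      then have y: "0 \<le> y" using x by simp
      have "H y \<le> max ((1 + p) / 2) (H \<eta>)"
        using T0[of y] \<eta>(2)[of y] y by (cases "y \<le> T") (auto simp: T_def le_max_iff_disj)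
      then show ?thesis using real h_eq[OF y] by (simp add: crit_h_def flip: ereal_max)
    next
      case PInf
      then show ?thesis using h_inf L p(2) by (simp add: le_max_iff_disj)
    qed (use x in auto)
  qed
  then have "H \<eta> = p" using H_le_p[of \<eta>] \<eta>(1) p by (auto simp: max_def split: if_splits)
  then have eq: "g \<eta> / (N + \<eta> - g \<eta>) = p - 1" by (simp add: H_def)
  have D\<eta>: "0 < N + \<eta> - g \<eta>" using D[of \<eta>] \<eta> by simp
  with eq have "g \<eta> = (p - 1) * (N + \<eta> - g \<eta>)" by (simp add: divide_eq_eq)
  then have scale: "p * (N + \<eta> - g \<eta>) = N + \<eta>" by (simp add: algebra_simps)
  have "0 < (p - 1) * (N + \<eta> - g \<eta>)" using D\<eta> p(2) by (intro mult_pos_pos) auto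
  then have g_pos: "0 < g \<eta>" using \<open>g \<eta> = _\<close> by linarith
  \<comment> \<open>The top order contributes (m - l) * 0 + 0 to the minimum at \<eta> = 0.\<close>
  have "g 0 \<le> 0"
    using crit_g_le[of m m d c l 0] top_order_active[OF norm] by (simp add: g_def)
  then have "\<eta> \<noteq> 0" using g_pos by auto
  show ?thesis
    by (rule that[of \<eta>]) (use \<eta>(1) \<open>\<eta> \<noteq> 0\<close> g_pos D\<eta> scale in \<open>auto simp: g_def N_def\<close>)
qed

section \<open>Products of one-dimensional functions\<close>

lemma component_le_mi_order: "\<alpha> i \<le> mi_order (\<alpha> :: 'n::finite \<Rightarrow> nat)"
  unfolding mi_order_def by (rule member_le_sum) auto

lemma finite_mi_order_le: "finite {\<alpha>::'n::finite \<Rightarrow> nat. mi_order \<alpha> \<le> k}"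
proof (rule finite_subset)
  show "{\<alpha>::'n \<Rightarrow> nat. mi_order \<alpha> \<le> k} \<subseteq> UNIV \<rightarrow>\<^sub>E {..k}"
    using component_le_mi_order order_trans by (fastforce simp: PiE_UNIV_domain)
qed (simp add: finite_PiE)

text \<open>Guarantees that the \<open>SOME\<close> in \<open>mi_deriv\<close> really selects a list
  with the prescribed multiplicities.\<close>

lemma exists_list_with_counts: "\<exists>is. \<forall>i::'n::finite. count_list is i = \<alpha> i"
proof -
  have "\<exists>is. \<forall>i. count_list is i = (if i \<in> S then \<alpha> i else 0)" if "finite S" for S
    using that
  proof induction
    case empty
    show ?case by (rule exI[of _ "[]"]) simp
  next
    case (insert a S)
    then obtain "is" where "\<forall>i. count_list is i = (if i \<in> S then \<alpha> i else 0)" by blast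
    moreover have "count_list (replicate k a) i = (if i = a then k else 0)" for k i
      by (induction k) auto
    ultimately show ?case
      using insert.hyps by (intro exI[of _ "replicate (\<alpha> a) a @ is"]) auto
  qed
  from this[of UNIV] show ?thesis by simp
qed

text \<open>The derivative of order \<open>\<alpha>\<close> of the product of copies of
  \<open>B\<close>, recorded by its order; the undifferentiated product is
  \<open>\<alpha> = (\<lambda>_. 0)\<close>. Partial differentiation merely raises one entry of
  \<open>\<alpha>\<close>.\<close>

definition tensor :: "(real \<Rightarrow> real) \<Rightarrow> ('n::finite \<Rightarrow> nat) \<Rightarrow> real^'n \<Rightarrow> real" where
  "tensor B \<alpha> x = (\<Prod>i\<in>UNIV. (deriv ^^ \<alpha> i) B (x $ i))"

lemma tensor_has_derivative:
  assumes "smooth_line B"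
  shows "(tensor B \<alpha> has_derivative
           (\<lambda>h. \<Sum>i\<in>UNIV. h $ i * tensor B (\<alpha>(i := Suc (\<alpha> i))) x)) (at x)"
proof -
  have "((\<lambda>x. (deriv ^^ \<alpha> i) B (x $ i)) has_derivative
          (\<lambda>h. h $ i * (deriv ^^ Suc (\<alpha> i)) B (x $ i))) (at x)" for i
    using has_derivative_compose[of "\<lambda>x. x $ i" "\<lambda>h. h $ i" x UNIV "(deriv ^^ \<alpha> i) B" "(*) ((deriv ^^ Suc (\<alpha> i)) B (x $ i))"]
      smooth_line_has_deriv[OF assms, of "\<alpha> i" "x $ i"]
    by (simp add: has_field_derivative_def bounded_linear_imp_has_derivative bounded_linear_vec_nth mult.commute)
  then have "(tensor B \<alpha> has_derivative
      (\<lambda>h. \<Sum>i\<in>UNIV. (h $ i * (deriv ^^ Suc (\<alpha> i)) B (x $ i)) *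
              (\<Prod>j\<in>UNIV - {i}. (deriv ^^ \<alpha> j) B (x $ j)))) (at x)"
    unfolding tensor_def[abs_def] by (rule has_derivative_prod)
  moreover have "tensor B (\<alpha>(i := Suc (\<alpha> i))) x =
      (deriv ^^ Suc (\<alpha> i)) B (x $ i) * (\<Prod>j\<in>UNIV - {i}. (deriv ^^ \<alpha> j) B (x $ j))" for i
    unfolding tensor_def by (subst prod.remove[of _ i]) (auto intro!: prod.cong)
  ultimately show ?thesis by (simp add: mult.assoc)
qed

lemma continuous_on_tensor: "smooth_line B \<Longrightarrow> continuous_on S (tensor B \<alpha>)"
  by (meson continuous_at_imp_continuous_on has_derivative_continuous tensor_has_derivative)

lemma sum_axis_mult: "(\<Sum>j\<in>UNIV. axis (i::'n::finite) (1::real) $ j * f j) = f i"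
  by (simp add: axis_def if_distrib[of "\<lambda>t. t * _"] sum.delta cong: if_cong)

lemma partial_deriv_tensor:
  assumes "smooth_line B"
  shows "partial_deriv (axis i 1) (\<lambda>x. a * tensor B \<alpha> x) = (\<lambda>x. a * tensor B (\<alpha>(i := Suc (\<alpha> i))) x)"
proof
  fix x
  have "((\<lambda>x. a * tensor B \<alpha> x) has_derivative
     (\<lambda>h. a * (\<Sum>i\<in>UNIV. h $ i * tensor B (\<alpha>(i := Suc (\<alpha> i))) x))) (at x)"
    by (intro has_derivative_mult_right tensor_has_derivative assms)
  from frechet_derivative_at[OF this, symmetric]
  show "partial_deriv (axis i 1) (\<lambda>x. a * tensor B \<alpha> x) x = a * tensor B (\<alpha>(i := Suc (\<alpha> i))) x"
    unfolding partial_deriv_def by (simp only: sum_axis_mult)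
qed

text \<open>Iterating along a list only records how often each direction occurs, so the choice of
  list hidden in \<open>mi_deriv\<close> is immaterial.\<close>

lemma mi_deriv_tensor:
  fixes \<alpha> :: "'n::finite \<Rightarrow> nat"
  assumes "smooth_line B"
  shows "mi_deriv \<alpha> (\<lambda>x. a * tensor B (\<lambda>_. 0) x) = (\<lambda>x. a * tensor B \<alpha> x)"
proof -
  have fold: "foldr partial_deriv (map (\<lambda>i. axis i 1) is) (\<lambda>x. a * tensor B (\<lambda>_. 0) x)
      = (\<lambda>x. a * tensor B (count_list is) x)" for "is" :: "'n list"
  proof (induction "is")
    case (Cons i "is")
    have "(count_list is)(i := Suc (count_list is i)) = count_list (i # is)" by auto
    then show ?case
      by (simp only: list.map foldr.simps comp_apply Cons partial_deriv_tensor[OF assms])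
  next
    case Nil
    have "count_list [] = (\<lambda>_::'n. 0)" by auto
    then show ?case by simp
  qed
  have "count_list (SOME is. \<forall>i. count_list is i = \<alpha> i) = \<alpha>"
    using someI_ex[OF exists_list_with_counts[of \<alpha>]] by auto
  then show ?thesis by (simp add: mi_deriv_def fold)
qed

lemma adjoint_op_tensor:
  assumes "smooth_line B"
  shows "adjoint_op d c j (\<lambda>x. a * tensor B (\<lambda>_. 0) x) x =
     (\<Sum>\<alpha> | mi_order \<alpha> \<le> d j. (- 1) ^ mi_order \<alpha> * c j \<alpha> * (a * tensor B \<alpha> x))"
  by (simp add: adjoint_op_def mi_deriv_tensor[OF assms])

lemma smooth_time_tensor:
  fixes A B :: "real \<Rightarrow> real"
  assumes A: "smooth_line A" and B: "smooth_line B"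
  shows "smooth (\<lambda>z::real \<times> (real^'n::finite). A (fst z) * tensor B (\<lambda>_. 0) (snd z))"
proof -
  \<comment> \<open>A basis direction of the product space raises either \<open>k\<close> or one
    entry of \<open>\<alpha>\<close>, so all iterated partial derivatives remain in this
    differentiable family.\<close>
  define G where "G k \<alpha> z = (deriv ^^ k) A (fst z) * tensor B \<alpha> (snd z)"
    for k and \<alpha> :: "'n \<Rightarrow> nat" and z :: "real \<times> (real^'n)"
  have G: "(G k \<alpha> has_derivative (\<lambda>h. (deriv ^^ k) A (fst z) *
       (\<Sum>i\<in>UNIV. snd h $ i * tensor B (\<alpha>(i := Suc (\<alpha> i))) (snd z)) +
       (fst h * (deriv ^^ Suc k) A (fst z)) * tensor B \<alpha> (snd z))) (at z)" for k \<alpha> z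
  proof -
    have 1: "((\<lambda>z. (deriv ^^ k) A (fst z)) has_derivative (\<lambda>h. fst h * (deriv ^^ Suc k) A (fst z))) (at z)"
      using has_derivative_compose[of fst fst z UNIV "(deriv ^^ k) A" "(*) ((deriv ^^ Suc k) A (fst z))"]
        smooth_line_has_deriv[OF A, of k "fst z"]
      by (simp add: has_field_derivative_def bounded_linear_imp_has_derivative bounded_linear_fst mult.commute)
    have 2: "((\<lambda>z. tensor B \<alpha> (snd z)) has_derivative
        (\<lambda>h. \<Sum>i\<in>UNIV. snd h $ i * tensor B (\<alpha>(i := Suc (\<alpha> i))) (snd z))) (at z)"
      using has_derivative_compose[of snd snd z UNIV "tensor B \<alpha>"] tensor_has_derivative[OF B, of \<alpha> "snd z"]
      by (simp add: bounded_linear_imp_has_derivative bounded_linear_snd)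
    show ?thesis unfolding G_def[abs_def] by (rule has_derivative_mult[OF 1 2])
  qed
  have step: "\<exists>k' \<alpha>'. partial_deriv b (G k \<alpha>) = G k' \<alpha>'" if b: "b \<in> Basis" for b k \<alpha>
  proof -
    have pd: "partial_deriv b (G k \<alpha>) z = (deriv ^^ k) A (fst z) *
       (\<Sum>i\<in>UNIV. snd b $ i * tensor B (\<alpha>(i := Suc (\<alpha> i))) (snd z)) +
       (fst b * (deriv ^^ Suc k) A (fst z)) * tensor B \<alpha> (snd z)" for z
      unfolding partial_deriv_def frechet_derivative_at[OF G, symmetric] ..
    from b consider "b = (1, 0)" | i where "b = (0, axis i 1)"
      by (auto simp: Basis_prod_def Basis_vec_def)
    then show ?thesis
    proof cases
      case 1
      have "partial_deriv b (G k \<alpha>) z = G (Suc k) \<alpha> z" for z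
        unfolding pd by (simp add: 1 G_def)
      then show ?thesis by blast
    next
      case (2 i)
      have "partial_deriv b (G k \<alpha>) z = G k (\<alpha>(i := Suc (\<alpha> i))) z" for z
        unfolding pd by (simp add: 2 G_def sum_axis_mult)
      then show ?thesis by blast
    qed
  qed
  have "\<exists>k \<alpha>. foldr partial_deriv bs (G 0 (\<lambda>_. 0)) = G k \<alpha>" if "set bs \<subseteq> Basis" for bs
    using that
  proof (induction bs)
    case (Cons b bs)
    then obtain k \<alpha> where "foldr partial_deriv bs (G 0 (\<lambda>_. 0)) = G k \<alpha>" by auto
    then show ?case using step[of b k \<alpha>] Cons.prems by auto
  qed auto
  moreover have "G k \<alpha> differentiable_on UNIV" for k \<alpha>
    unfolding differentiable_on_def differentiable_def using G by blast
  ultimately have "smooth (G 0 (\<lambda>_. 0))" unfolding smooth_def by metis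
  then show ?thesis by (simp add: G_def[abs_def])
qed

section \<open>Time derivatives of integer order for separated functions\<close>

fun tail_primitive :: "nat \<Rightarrow> (real \<Rightarrow> real) \<Rightarrow> real \<Rightarrow> real" where
  "tail_primitive 0 A t = A t"
| "tail_primitive (Suc k) A t = - (LBINT \<tau>:{t..}. tail_primitive k A \<tau>)"

definition line_deriv :: "int \<Rightarrow> (real \<Rightarrow> real) \<Rightarrow> real \<Rightarrow> real" where
  "line_deriv k A = (if 0 \<le> k then (deriv ^^ nat k) A else tail_primitive (nat (- k)) A)"

lemma deriv_mult_const:
  assumes "smooth_line A"
  shows "(deriv ^^ k) (\<lambda>s. A s * a) = (\<lambda>s. (deriv ^^ k) A s * (a::real))"
proof (induction k)
  case (Suc k)
  have "deriv (\<lambda>s. (deriv ^^ k) A s * a) s = (deriv ^^ Suc k) A s * a" for s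
    by (intro DERIV_imp_deriv DERIV_cmult_right smooth_line_has_deriv assms)
  with Suc show ?case by simp
qed simp

lemma time_deriv_product:
  assumes "smooth_line A"
  shows "time_deriv \<infinity> k (\<lambda>z. A (fst z) * S (snd z)) (t, x) = line_deriv k A t * S x"
proof -
  have "time_primitive \<infinity> i (\<lambda>z. A (fst z) * S (snd z)) (t, x) = tail_primitive i A t * S x" for i
  proof (induction i arbitrary: t)
    case (Suc i)
    have "{\<tau>. t \<le> \<tau> \<and> ereal \<tau> < \<infinity>} = {t..}" by auto
    then show ?case by (simp add: Suc)
  qed simp
  then show ?thesis
    by (simp add: time_deriv_def line_deriv_def deriv_mult_const[OF assms])
qed

text \<open>If \<open>f\<close> is not integrable, its Bochner integral is 0 by default and the
  bound follows from 0 \<le> g. This spares integrability checks for the primitives and for the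
  terms of the weak identity.\<close>

lemma abs_integral_le:
  fixes f g :: "'a \<Rightarrow> real"
  assumes "\<And>x. x \<in> space M \<Longrightarrow> \<bar>f x\<bar> \<le> g x" "integrable M g"
  shows "\<bar>lebesgue_integral M f\<bar> \<le> lebesgue_integral M g"
proof (cases "integrable M f")
  case True
  then have "\<bar>lebesgue_integral M f\<bar> \<le> (\<integral>x. \<bar>f x\<bar> \<partial>M)" by simp
  also have "\<dots> \<le> lebesgue_integral M g" using True assms by (intro integral_mono) auto
  finally show ?thesis .
next
  case False
  moreover have "0 \<le> lebesgue_integral M g"
    using assms(1) by (intro Bochner_Integration.integral_nonneg) (meson abs_ge_zero order_trans)
  ultimately show ?thesis by (simp add: not_integrable_integral_eq)
qed

text \<open>Each integration effectively runs over [t, L], an interval of length at most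
  \<open>L\<close>, on which the integrand is bounded through A(\<tau>) \<le> A(t).\<close>

lemma abs_tail_primitive_le:
  assumes "0 \<le> L" "antimono_on {0..} A" "\<And>t. L \<le> t \<Longrightarrow> A t = 0" "0 \<le> t"
  shows "\<bar>tail_primitive k A t\<bar> \<le> L ^ k * A t"
  using assms(4)
proof (induction k arbitrary: t)
  case 0
  have "A (max t L) \<le> A t" using assms(1,2) 0 by (auto simp: monotone_on_def)
  then show ?case using assms(3)[of "max t L"] by simp
next
  case (Suc k)
  have mono: "A \<tau> \<le> A t" if "t \<le> \<tau>" for \<tau> using assms(2) Suc.prems that by (auto simp: monotone_on_def)
  have A_nonneg: "0 \<le> A t" using mono[of "max t L"] assms(3)[of "max t L"] by simp
  have "\<bar>tail_primitive (Suc k) A t\<bar> = \<bar>\<integral>\<tau>. indicator {t..} \<tau> * tail_primitive k A \<tau> \<partial>lborel\<bar>"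
    by (simp add: set_lebesgue_integral_def)
  also have "\<dots> \<le> (\<integral>\<tau>. L ^ k * A t * indicator {t..max t L} \<tau> \<partial>lborel)"
  proof (rule abs_integral_le)
    fix \<tau> :: real
    have IH: "t \<le> \<tau> \<Longrightarrow> \<bar>tail_primitive k A \<tau>\<bar> \<le> L ^ k * A \<tau>" using Suc by simp
    also have "t \<le> \<tau> \<Longrightarrow> L ^ k * A \<tau> \<le> L ^ k * A t" using mono assms(1) by (intro mult_left_mono) auto
    finally show "\<bar>indicator {t..} \<tau> * tail_primitive k A \<tau>\<bar> \<le> L ^ k * A t * indicator {t..max t L} \<tau>"
      using IH assms(3)[of \<tau>] by (auto simp: indicator_def)
  qed simp
  also have "\<dots> = L ^ k * (A t * (max t L - t))" by simp
  also have "\<dots> \<le> L ^ k * (A t * L)"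
    using assms(1,3) Suc.prems A_nonneg
    by (cases "t \<le> L") (auto intro!: mult_left_mono mult_nonneg_nonneg)
  finally show ?case by (simp add: mult.commute mult.left_commute)
qed

section \<open>The scaled test functions\<close>

definition bump :: "(real \<Rightarrow> real) \<Rightarrow> real \<Rightarrow> real \<Rightarrow> real \<times> (real^'n::finite) \<Rightarrow> real" where
  "bump X \<rho> R z = X (fst z / \<rho>) * tensor (\<lambda>s. X (s / R)) (\<lambda>_. 0) (snd z)"

definition inner_box :: "real \<Rightarrow> real \<Rightarrow> (real \<times> (real^'n::finite)) set" where
  "inner_box \<rho> R = {z. \<bar>fst z\<bar> < \<rho> \<and> (\<forall>i. \<bar>snd z $ i\<bar> < R)}"

text \<open>The sharp cut at the box makes this discontinuous, but it only occurs as a measurable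
  weight. A bound by its root expresses at once the root bound for cutoffs and the vanishing inside
  the box.\<close>

definition outer_part :: "(real \<Rightarrow> real) \<Rightarrow> real \<Rightarrow> real \<Rightarrow> real \<times> (real^'n::finite) \<Rightarrow> real" where
  "outer_part X \<rho> R z = (if z \<in> inner_box \<rho> R then 0 else bump X \<rho> R z)"

lemma smooth_line_scale: "smooth_line X \<Longrightarrow> smooth_line (\<lambda>s. X (s / R))"
  using smooth_line_affine[of X "1 / R" 0] by simp

lemma higher_deriv_scale:
  "smooth_line X \<Longrightarrow> (deriv ^^ k) (\<lambda>s. X (s / R)) s = (deriv ^^ k) X (s / R) / R ^ k"
  using fun_cong[OF deriv_scaled[of X k "1 / R" 0], of s] by (simp add: power_divide)

lemma smooth_bump: "smooth_line X \<Longrightarrow> smooth (bump X \<rho> R)"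
  unfolding bump_def[abs_def] by (intro smooth_time_tensor smooth_line_scale)

lemma bump_eq_prod: "bump X \<rho> R z = X (fst z / \<rho>) * (\<Prod>i\<in>UNIV. X (snd z $ i / R))"
  by (simp add: bump_def tensor_def)

lemma bump_range:
  assumes "cutoff p M K X"
  shows "0 \<le> bump X \<rho> R z" "bump X \<rho> R z \<le> 1"
  unfolding bump_eq_prod using cutoffD[OF assms]
  by (auto intro!: mult_nonneg_nonneg mult_le_one prod_nonneg prod_le_1)

lemma bump_eq_1:
  assumes "cutoff p M K X" "0 < \<rho>" "0 < R" "\<bar>fst z\<bar> \<le> \<rho>" "\<And>i. \<bar>snd z $ i\<bar> \<le> R"
  shows "bump X \<rho> R z = 1"
  unfolding bump_eq_prod using assms by (simp add: cutoffD(5)[OF assms(1)])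

lemma bump_eq_0:
  assumes "cutoff p M K X" "0 < \<rho>" "0 < R" "2 * \<rho> \<le> \<bar>fst z\<bar> \<or> 2 * R \<le> \<bar>snd z $ i\<bar>"
  shows "bump X \<rho> R z = 0"
proof -
  have "X (fst z / \<rho>) = 0 \<or> X (snd z $ i / R) = 0"
    using assms(2-4) by (auto intro!: cutoffD(6)[OF assms(1)] simp: field_simps)
  then show ?thesis unfolding bump_eq_prod by (auto intro!: prod_zero)
qed

lemma abs_tensor_le:
  fixes \<alpha> :: "'n::finite \<Rightarrow> nat"
  assumes X: "cutoff p M K X" and "0 < R" "\<And>i. \<alpha> i \<le> M"
  shows "\<bar>tensor (\<lambda>s. X (s / R)) \<alpha> x\<bar> \<le>
     K ^ CARD('n) * (tensor (\<lambda>s. X (s / R)) (\<lambda>_. 0) x powr (1 / p) / R ^ mi_order \<alpha>)"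
proof -
  have "\<bar>tensor (\<lambda>s. X (s / R)) \<alpha> x\<bar> = (\<Prod>i\<in>UNIV. \<bar>(deriv ^^ \<alpha> i) X (x $ i / R)\<bar> / R ^ \<alpha> i)"
    using assms(2) by (simp add: tensor_def higher_deriv_scale[OF cutoffD(1)[OF X]] abs_prod abs_divide)
  also have "\<dots> \<le> (\<Prod>i\<in>UNIV. K * (X (x $ i / R) powr (1 / p) / R ^ \<alpha> i))"
  proof (intro prod_mono conjI)
    fix i
    show "\<bar>(deriv ^^ \<alpha> i) X (x $ i / R)\<bar> / R ^ \<alpha> i \<le> K * (X (x $ i / R) powr (1 / p) / R ^ \<alpha> i)"
      using divide_right_mono[OF cutoffD(8)[OF X assms(3)], of "R ^ \<alpha> i"] assms(2) by simp
  qed (use assms(2) in auto)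
  also have "\<dots> = K ^ CARD('n) * ((\<Prod>i\<in>UNIV. X (x $ i / R)) powr (1 / p) / R ^ mi_order \<alpha>)"
    using cutoffD(3)[OF X] by (simp add: prod.distrib prod_dividef power_sum mi_order_def prod_powr_distrib)
  finally show ?thesis by (simp add: tensor_def)
qed

text \<open>Orders of both signs scale like \<rho>^(-k). For negative \<open>k\<close> the
  primitives are taken over a length of at most 2\<rho>, which produces the factor
  \<open>2 ^ m\<close>, and X \<le> X^(1/p) because 0 \<le> X \<le> 1.\<close>

lemma abs_line_deriv_le:
  assumes X: "cutoff p M K X" and "1 < p" "0 < \<rho>" "0 \<le> t" "nat k \<le> M" "nat (- k) \<le> m"
  shows "\<bar>line_deriv k (\<lambda>s. X (s / \<rho>)) t\<bar> \<le> 2 ^ m * K * (\<rho> powr (- k) * X (t / \<rho>) powr (1 / p))"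
proof (cases "0 \<le> k")
  case True
  have "\<bar>line_deriv k (\<lambda>s. X (s / \<rho>)) t\<bar> = \<bar>(deriv ^^ nat k) X (t / \<rho>)\<bar> / \<rho> ^ nat k"
    using True assms(3) by (simp add: line_deriv_def higher_deriv_scale[OF cutoffD(1)[OF X]] abs_divide)
  also have "\<dots> \<le> K * X (t / \<rho>) powr (1 / p) / \<rho> ^ nat k"
    using assms(3,5) cutoffD(8)[OF X] by (intro divide_right_mono) auto
  also have "\<dots> = 1 * (K * (\<rho> powr (- k) * X (t / \<rho>) powr (1 / p)))"
    using True assms(3) by (simp add: powr_minus_divide flip: powr_realpow)
  also have "\<dots> \<le> 2 ^ m * (K * (\<rho> powr (- k) * X (t / \<rho>) powr (1 / p)))"
    using cutoffD(2)[OF X] by (intro mult_right_mono) auto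
  finally show ?thesis by (simp add: mult.assoc)
next
  case False
  define i where "i = nat (- k)"
  have "\<bar>tail_primitive i (\<lambda>s. X (s / \<rho>)) t\<bar> \<le> (2 * \<rho>) ^ i * X (t / \<rho>)"
    using assms(3,4) cutoffD(7)[OF X]
    by (intro abs_tail_primitive_le)
       (auto simp: monotone_on_def divide_right_mono field_simps intro!: cutoffD(6)[OF X])
  also have "X (t / \<rho>) \<le> X (t / \<rho>) powr (1 / p)"
    using powr_mono'[of "1 / p" 1 "X (t / \<rho>)"] cutoffD(3,4)[OF X] assms(2) by simp
  also have "(2 * \<rho>) ^ i * X (t / \<rho>) powr (1 / p) = 2 ^ i * (\<rho> powr (- k) * X (t / \<rho>) powr (1 / p))"
    using False assms(3) by (simp add: i_def power_mult_distrib flip: powr_realpow)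
  also have "\<dots> \<le> (2 ^ m * K) * (\<rho> powr (- k) * X (t / \<rho>) powr (1 / p))"
  proof (intro mult_right_mono)
    have "(2::real) ^ i \<le> 2 ^ m" using assms(6) by (intro power_increasing) (auto simp: i_def)
    also have "(2::real) ^ m * 1 \<le> 2 ^ m * K" using cutoffD(2)[OF X] by (intro mult_left_mono) auto
    finally show "2 ^ i \<le> 2 ^ m * K" by simp
  qed simp
  finally show ?thesis using False assms(3) by (simp add: line_deriv_def i_def mult_left_mono)
qed

lemma line_deriv_eq_0:
  assumes X: "cutoff p M K X" and "0 < \<rho>" "\<bar>t\<bar> < \<rho>" "0 < k"
  shows "line_deriv k (\<lambda>s. X (s / \<rho>)) t = 0"
proof -
  have "(deriv ^^ nat k) (\<lambda>s. X (s / \<rho>)) t = 0"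
    by (rule higher_deriv_locally_const[of "{-\<rho><..<\<rho>}" _ 1])
       (use assms in \<open>auto intro!: cutoffD(5)[OF X] simp: field_simps abs_le_iff\<close>)
  then show ?thesis using assms(4) by (simp add: line_deriv_def)
qed

lemma tensor_cutoff_eq_0:
  fixes \<alpha> :: "'n::finite \<Rightarrow> nat"
  assumes X: "cutoff p M K X" and "0 < R" "\<And>i. \<bar>x $ i\<bar> < R" "0 < mi_order \<alpha>"
  shows "tensor (\<lambda>s. X (s / R)) \<alpha> x = 0"
proof -
  have "mi_order \<alpha> \<noteq> 0" using assms(4) by simp
  then obtain i where i: "0 < \<alpha> i" by (auto simp: mi_order_def)
  have "(deriv ^^ \<alpha> i) (\<lambda>s. X (s / R)) (x $ i) = 0"
    by (rule higher_deriv_locally_const[of "{-R<..<R}" _ 1])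
       (use assms(2) assms(3)[of i] i in \<open>auto intro!: cutoffD(5)[OF X] simp: field_simps abs_le_iff abs_less_iff\<close>)
  then show ?thesis unfolding tensor_def by (intro prod_zero) auto
qed

text \<open>For \<open>j \<le> l\<close> the factor \<open>\<partial>\<^sub>t\<^sup>(\<^sup>j\<^sup>-\<^sup>l\<^sup>)\<psi>\<close> does not vanish near the origin. That the term is still
  controlled by \<^const>\<open>outer_part\<close> is due to \<open>g(\<eta>) > 0\<close>, which forces \<open>P\<^sub>j\<close> to differentiate in \<open>x\<close>.\<close>

lemma adjoint_op_bump_le:
  fixes d :: "nat \<Rightarrow> nat" and c :: "nat \<Rightarrow> ('n::finite \<Rightarrow> nat) \<Rightarrow> real"
  assumes X: "cutoff p M K X" and p: "1 < p" and M: "m \<le> M" "d j \<le> M" and j: "j \<le> m" and l: "l \<le> m"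
    and \<eta>: "0 < \<eta>" and g: "0 < crit_g m d c l \<eta>"
  shows "\<exists>C\<ge>0. \<forall>R\<ge>1. \<forall>t\<ge>0. \<forall>x.
    \<bar>adjoint_op d c j (\<lambda>y. time_deriv \<infinity> (int j - int l) (bump X (R powr \<eta>) R) (t, y)) x\<bar>
      \<le> C * R powr (- crit_g m d c l \<eta>) * outer_part X (R powr \<eta>) R (t, x) powr (1 / p)"
proof (intro exI conjI allI impI)
  let ?S = "{\<alpha>::'n \<Rightarrow> nat. mi_order \<alpha> \<le> d j}"
  let ?k = "int j - int l"
  define g0 where "g0 = crit_g m d c l \<eta>"
  define C1 where "C1 = 2 ^ m * K * K ^ CARD('n)"
  have C1: "0 \<le> C1" using cutoffD(2)[OF X] by (simp add: C1_def)
  then show "0 \<le> (\<Sum>\<alpha>\<in>?S. \<bar>c j \<alpha>\<bar> * C1)" by (intro sum_nonneg) simp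
  fix R t :: real and x :: "real^'n" assume R: "1 \<le> R" and t: "0 \<le> t"
  define \<rho> where "\<rho> = R powr \<eta>"
  have \<rho>: "0 < \<rho>" using R by (simp add: \<rho>_def)
  define B where "B = (\<lambda>s. X (s / R))"
  have B: "smooth_line B" unfolding B_def by (rule smooth_line_scale[OF cutoffD(1)[OF X]])
  define D where "D = line_deriv ?k (\<lambda>s. X (s / \<rho>)) t"
  define \<theta> where "\<theta> = outer_part X \<rho> R (t, x) powr (1 / p)"
  have term_le: "\<bar>(- 1) ^ mi_order \<alpha> * c j \<alpha> * (D * tensor B \<alpha> x)\<bar> \<le> \<bar>c j \<alpha>\<bar> * C1 * (R powr (- g0) * \<theta>)"
    if \<alpha>: "\<alpha> \<in> ?S" for \<alpha>
  proof (cases "c j \<alpha> = 0")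
    case False
    have \<alpha>_supp: "\<alpha> \<in> symbol_supp d c j" using \<alpha> False by (simp add: symbol_supp_def)
    then have "min_order d c j \<le> mi_order \<alpha>"
      unfolding min_order_def by (intro cInf_lower) auto
    moreover have "g0 \<le> (real j - real l) * \<eta> + real (min_order d c j)"
      unfolding g0_def by (rule crit_g_le) (use \<alpha>_supp j in \<open>auto simp: active_orders_def\<close>)
    ultimately have g0_le: "g0 \<le> real_of_int ?k * \<eta> + real (mi_order \<alpha>)" by simp
    have "\<bar>D * tensor B \<alpha> x\<bar> \<le> C1 * (R powr (- g0) * \<theta>)"
    proof (cases "(t, x) \<in> inner_box \<rho> R")
      case True
      \<comment> \<open>Positivity of this exponent means that the term carries a genuine time
        derivative or a genuine space derivative; that factor vanishes in the box.\<close>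
      have "0 < real_of_int ?k * \<eta> + real (mi_order \<alpha>)" using g0_le g by (simp add: g0_def)
      then have "0 < ?k \<or> 0 < mi_order \<alpha>"
        using \<eta> by (metis add_cancel_right_right gr_zeroI linorder_not_less mult_nonpos_nonneg of_int_le_0_iff of_nat_0 order_less_imp_le)
      then have "D = 0 \<or> tensor B \<alpha> x = 0"
        using True line_deriv_eq_0[OF X \<rho>, of t ?k] tensor_cutoff_eq_0[OF X, of R x \<alpha>] R
        by (auto simp: D_def B_def inner_box_def)
      then show ?thesis using C1 by (auto simp: \<theta>_def)
    next
      case outer: False
      have "\<bar>D * tensor B \<alpha> x\<bar> \<le> (2 ^ m * K * (\<rho> powr (- ?k) * X (t / \<rho>) powr (1 / p))) *
          (K ^ CARD('n) * (tensor B (\<lambda>_. 0) x powr (1 / p) / R ^ mi_order \<alpha>))"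
        unfolding abs_mult
      proof (rule mult_mono)
        show "\<bar>D\<bar> \<le> 2 ^ m * K * (\<rho> powr (- ?k) * X (t / \<rho>) powr (1 / p))"
          unfolding D_def by (rule abs_line_deriv_le[OF X p \<rho> t]) (use M j l in auto)
        have "\<alpha> i \<le> M" for i using component_le_mi_order[of \<alpha> i] \<alpha> M(2) by simp
        then show "\<bar>tensor B \<alpha> x\<bar> \<le> K ^ CARD('n) * (tensor B (\<lambda>_. 0) x powr (1 / p) / R ^ mi_order \<alpha>)"
          unfolding B_def using R by (intro abs_tensor_le[OF X]) auto
      qed (use cutoffD(2)[OF X] in auto)
      also have "\<dots> = C1 * ((\<rho> powr (- ?k) / R ^ mi_order \<alpha>) * (X (t / \<rho>) powr (1 / p) * tensor B (\<lambda>_. 0) x powr (1 / p)))"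
        by (simp add: C1_def)
      also have "X (t / \<rho>) powr (1 / p) * tensor B (\<lambda>_. 0) x powr (1 / p) = \<theta>"
        using outer cutoffD(3)[OF X]
        by (simp add: \<theta>_def outer_part_def bump_def B_def powr_mult tensor_def prod_nonneg)
      \<comment> \<open>With \<rho> = R^\<eta> the exponent is the affine expression from the
        definition of \<open>crit_g\<close>, with the order of \<open>\<alpha>\<close> in place of
        the minimal order; as R \<ge> 1, it may be replaced by \<open>g0\<close>.\<close>
      also have "\<rho> powr (- ?k) / R ^ mi_order \<alpha> = R powr (- (real_of_int ?k * \<eta> + real (mi_order \<alpha>)))"
        using R by (simp add: \<rho>_def powr_powr powr_diff powr_minus powr_realpow powr_add divide_inverse mult.commute algebra_simps)
      also have "C1 * (R powr (- (real_of_int ?k * \<eta> + real (mi_order \<alpha>))) * \<theta>) \<le> C1 * (R powr (- g0) * \<theta>)"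
        using g0_le R C1 by (intro mult_left_mono mult_right_mono powr_mono) (auto simp: \<theta>_def)
      finally show ?thesis .
    qed
    then show ?thesis by (simp add: abs_mult mult.assoc mult_left_mono)
  qed simp
  have "adjoint_op d c j (\<lambda>y. time_deriv \<infinity> ?k (bump X \<rho> R) (t, y)) x =
      (\<Sum>\<alpha>\<in>?S. (- 1) ^ mi_order \<alpha> * c j \<alpha> * (D * tensor B \<alpha> x))"
  proof -
    have "(\<lambda>y. time_deriv \<infinity> ?k (bump X \<rho> R) (t, y)) = (\<lambda>y. D * tensor B (\<lambda>_. 0) y)"
      unfolding bump_def[abs_def] D_def B_def
      by (intro ext time_deriv_product smooth_line_scale cutoffD(1)[OF X])
    then show ?thesis by (rule ssubst) (rule adjoint_op_tensor[OF B])
  qed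
  also have "\<bar>\<dots>\<bar> \<le> (\<Sum>\<alpha>\<in>?S. \<bar>c j \<alpha>\<bar> * C1 * (R powr (- g0) * \<theta>))"
    by (intro order_trans[OF sum_abs] sum_mono term_le)
  also have "\<dots> = (\<Sum>\<alpha>\<in>?S. \<bar>c j \<alpha>\<bar> * C1) * (R powr (- g0) * \<theta>)"
    by (simp add: sum_distrib_right)
  finally show "\<bar>adjoint_op d c j (\<lambda>y. time_deriv \<infinity> ?k (bump X (R powr \<eta>) R) (t, y)) x\<bar>
      \<le> (\<Sum>\<alpha>\<in>?S. \<bar>c j \<alpha>\<bar> * C1) * R powr (- crit_g m d c l \<eta>) * outer_part X (R powr \<eta>) R (t, x) powr (1 / p)"
    by (simp add: \<rho>_def g0_def \<theta>_def mult.assoc)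
qed

section \<open>Admissibility of the test functions and the limit of the data terms\<close>

lemma open_inner_box: "open (inner_box \<rho> R :: (real \<times> (real^'n::finite)) set)"
proof -
  have "inner_box \<rho> R = {z::real \<times> (real^'n). \<bar>fst z\<bar> < \<rho>} \<inter> (\<Inter>i\<in>UNIV. {z. \<bar>snd z $ i\<bar> < R})"
    by (auto simp: inner_box_def)
  moreover have "open {z::real \<times> (real^'n). \<bar>fst z\<bar> < \<rho>}"
    by (intro open_Collect_less continuous_intros)
  moreover have "open {z::real \<times> (real^'n). \<bar>snd z $ i\<bar> < R}" for i
    by (intro open_Collect_less continuous_intros)
  ultimately show ?thesis by (simp add: open_Int open_INT)
qed

lemma continuous_on_bump:
  assumes "smooth_line X"
  shows "continuous_on S (bump X \<rho> R :: real \<times> (real^'n::finite) \<Rightarrow> real)"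
proof -
  have "continuous_on UNIV (\<lambda>s. X (s / \<rho>))"
    using smooth_line_continuous_on[OF smooth_line_scale[OF assms, of \<rho>], of UNIV 0] by simp
  then have "continuous_on S (\<lambda>z::real \<times> (real^'n). X (fst z / \<rho>))"
    by (rule continuous_on_compose2[of UNIV "\<lambda>s. X (s / \<rho>)"]) (auto simp: continuous_on_fst continuous_on_id)
  moreover have "continuous_on S (\<lambda>z::real \<times> (real^'n). tensor (\<lambda>s. X (s / R)) (\<lambda>_. 0) (snd z))"
    using continuous_on_tensor[OF smooth_line_scale[OF assms, of R], of UNIV "\<lambda>_::'n. 0"]
    by (rule continuous_on_compose2) (auto simp: continuous_on_snd continuous_on_id)
  ultimately show ?thesis unfolding bump_def[abs_def] by (rule continuous_on_mult)
qed

lemma test_fun_bump: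
  assumes X: "cutoff p M K X" and \<rho>: "0 < \<rho>" and R: "0 < R"
  shows "test_fun \<infinity> (bump X \<rho> R :: real \<times> (real^'n::finite) \<Rightarrow> real)"
proof -
  have "{z::real \<times> (real^'n). bump X \<rho> R z \<noteq> 0} \<subseteq> {-2 * \<rho>..2 * \<rho>} \<times> cbox (\<chi> i. - 2 * R) (\<chi> i. 2 * R)"
  proof
    fix z :: "real \<times> (real^'n)" assume "z \<in> {z. bump X \<rho> R z \<noteq> 0}"
    then have "\<not> (2 * \<rho> \<le> \<bar>fst z\<bar> \<or> 2 * R \<le> \<bar>snd z $ i\<bar>)" for i
      using bump_eq_0[OF X \<rho> R, of z i] by blast
    then have "\<bar>fst z\<bar> < 2 * \<rho>" "\<And>i. \<bar>snd z $ i\<bar> < 2 * R" by (auto simp: not_le)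
    then show "z \<in> {-2 * \<rho>..2 * \<rho>} \<times> cbox (\<chi> i. - 2 * R) (\<chi> i. 2 * R)"
      by (cases z) (auto simp: mem_box_cart abs_less_iff less_imp_le minus_le_iff)
  qed
  then have "bounded {z::real \<times> (real^'n). bump X \<rho> R z \<noteq> 0}"
    by (rule bounded_subset[rotated]) (intro bounded_Times bounded_cbox bounded_closed_interval)
  then show ?thesis
    using smooth_bump[OF cutoffD(1)[OF X]] by (auto simp: test_fun_def supp_def)
qed

lemma one_near_origin_bump:
  assumes "cutoff p M K X" "0 < \<rho>" "0 < R"
  shows "one_near_origin (bump X \<rho> R :: real \<times> (real^'n::finite) \<Rightarrow> real)"
proof -
  have "(0, 0) \<in> (inner_box \<rho> R :: (real \<times> (real^'n)) set)" using assms by (simp add: inner_box_def)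
  then have "\<forall>\<^sub>F z in nhds (0, 0). z \<in> (inner_box \<rho> R :: (real \<times> (real^'n)) set)"
    using open_inner_box eventually_nhds by blast
  then show ?thesis
    unfolding one_near_origin_def
    by eventually_elim (auto intro!: bump_eq_1[OF assms] simp: inner_box_def less_imp_le)
qed

text \<open>For fixed \<open>x\<close>, once R exceeds |x|, the spatial product is 1 near
  \<open>x\<close>, so its derivatives vanish and only the zero-order coefficient remains. The
  bounds of \<open>abs_tensor_le\<close> with R \<ge> 1 give a multiple of |u| as dominating
  function.\<close>

lemma data_term_tendsto:
  fixes u :: "real^'n::finite \<Rightarrow> real" and R \<rho> :: "nat \<Rightarrow> real"
  assumes p: "1 < p" and X: "cutoff p M K X" and M: "d j \<le> M" and u: "integrable lborel u"
    and R: "\<And>k. 1 \<le> R k" "filterlim R at_top sequentially" and \<rho>: "\<And>k. 0 < \<rho> k"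
  shows "(\<lambda>k. LBINT x. u x * adjoint_op d c j (\<lambda>y. bump X (\<rho> k) (R k) (0, y)) x)
           \<longlonglongrightarrow> c j (\<lambda>_. 0) * (LBINT x. u x)"
proof -
  let ?S = "{\<alpha>::'n \<Rightarrow> nat. mi_order \<alpha> \<le> d j}"
  define T where "T k \<alpha> = tensor (\<lambda>s. X (s / R k)) \<alpha>" for k and \<alpha> :: "'n \<Rightarrow> nat"
  define E where "E k x = (\<Sum>\<alpha>\<in>?S. (- 1) ^ mi_order \<alpha> * c j \<alpha> * T k \<alpha> x)" for k x
  have B: "smooth_line (\<lambda>s. X (s / R k))" for k by (rule smooth_line_scale[OF cutoffD(1)[OF X]])
  have adj: "adjoint_op d c j (\<lambda>y. bump X (\<rho> k) (R k) (0, y)) x = E k x" for k x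
    using adjoint_op_tensor[OF B, of d c j 1 k x] cutoffD(5)[OF X, of 0]
    by (simp add: bump_def E_def T_def)
  have K: "1 \<le> K" by (rule cutoffD(2)[OF X])
  have T_le: "\<bar>T k \<alpha> x\<bar> \<le> K ^ CARD('n)" if "\<alpha> \<in> ?S" for k \<alpha> x
  proof -
    have "\<alpha> i \<le> M" for i using component_le_mi_order[of \<alpha> i] that M by simp
    then have "\<bar>T k \<alpha> x\<bar> \<le> K ^ CARD('n) * (T k (\<lambda>_. 0) x powr (1 / p) / R k ^ mi_order \<alpha>)"
      unfolding T_def by (intro abs_tensor_le[OF X]) (use R(1)[of k] in auto)
    also have "T k (\<lambda>_. 0) x powr (1 / p) / R k ^ mi_order \<alpha> \<le> 1 / 1"
    proof (intro frac_le)
      have "0 \<le> T k (\<lambda>_. 0) x" "T k (\<lambda>_. 0) x \<le> 1"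
        using cutoffD(3,4)[OF X] by (auto simp: T_def tensor_def intro!: prod_nonneg prod_le_1)
      then show "T k (\<lambda>_. 0) x powr (1 / p) \<le> 1"
        using p by (intro powr_le1) auto
    qed (use R(1)[of k] in auto)
    finally show ?thesis using K by (simp add: mult_left_mono)
  qed
  have lim: "(\<lambda>k. E k x) \<longlonglongrightarrow> c j (\<lambda>_. 0)" for x
  proof (rule tendsto_eventually)
    have "\<forall>\<^sub>F k in sequentially. norm x < R k"
      using R(2) by (auto simp: filterlim_at_top_dense)
    then show "\<forall>\<^sub>F k in sequentially. E k x = c j (\<lambda>_. 0)"
    proof eventually_elim
      case (elim k)
      have x: "\<bar>x $ i\<bar> < R k" for i using component_le_norm_cart[of x i] elim by linarith
      have R_pos: "0 < R k" using R(1)[of k] by simp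
      have "T k \<alpha> x = (if \<alpha> = (\<lambda>_. 0) then 1 else 0)" for \<alpha>
      proof (cases "\<alpha> = (\<lambda>_. 0)")
        case True
        have "X (x $ i / R k) = 1" for i
          using x[of i] R_pos by (intro cutoffD(5)[OF X]) simp
        then show ?thesis by (simp add: True T_def tensor_def)
      next
        case False
        then have "mi_order \<alpha> \<noteq> 0" by (auto simp: mi_order_def)
        then show ?thesis using False tensor_cutoff_eq_0[OF X R_pos x] by (simp add: T_def)
      qed
      then have "E k x = (\<Sum>\<alpha>\<in>?S. if \<alpha> = (\<lambda>_. 0) then c j (\<lambda>_. 0) else 0)"
        unfolding E_def by (intro sum.cong) auto
      also have "\<dots> = c j (\<lambda>_. 0)" using finite_mi_order_le[where 'n='n, of "d j"] by (simp add: sum.delta)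
      finally show ?case .
    qed
  qed
  define C where "C = (\<Sum>\<alpha>\<in>?S. \<bar>c j \<alpha>\<bar> * K ^ CARD('n))"
  have E_le: "\<bar>E k x\<bar> \<le> C" for k x
    unfolding E_def C_def
    by (intro order_trans[OF sum_abs] sum_mono) (auto simp: abs_mult intro!: mult_left_mono T_le)
  have [measurable]: "u \<in> borel_measurable lborel" using u by simp
  have [measurable]: "T k \<alpha> \<in> borel_measurable lborel" for k \<alpha>
    using borel_measurable_continuous_onI[OF continuous_on_tensor[OF B]] by (simp add: T_def)
  have [measurable]: "E k \<in> borel_measurable lborel" for k
    unfolding E_def[abs_def] by measurable
  have "(\<lambda>k. LBINT x. u x * E k x) \<longlonglongrightarrow> (LBINT x. u x * c j (\<lambda>_. 0))"
  proof (rule integral_dominated_convergence)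
    show "integrable lborel (\<lambda>x. \<bar>u x\<bar> * C)" using u by simp
    show "AE x in lborel. (\<lambda>k. u x * E k x) \<longlonglongrightarrow> u x * c j (\<lambda>_. 0)"
      by (intro AE_I2 tendsto_mult tendsto_const lim)
    show "AE x in lborel. norm (u x * E k x) \<le> \<bar>u x\<bar> * C" for k
      by (intro AE_I2) (auto simp: abs_mult intro!: mult_left_mono E_le)
  qed auto
  then show ?thesis by (simp add: adj mult.commute)
qed

section \<open>Superlinear growth and the Dini condition\<close>

text \<open>If \<open>b\<^sub>2 \<le> 2 b\<^sub>1\<close> this is the mean value theorem; otherwise \<open>b\<^sup>-\<^sup>q\<close> drops by a fixed proportion.\<close>

lemma power_drop:
  fixes b0 b1 b2 :: real
  assumes "0 < q" "0 < b0" "b0 \<le> b1" "b1 \<le> b2"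
  shows "min b1 (b2 - b0) * b1 powr (- q - 1)
    \<le> max (2 powr (q + 1) / q) (1 / (1 - 2 powr (- q))) * (b0 powr (- q) - b2 powr (- q))"
proof (cases "b2 \<le> 2 * b1")
  case True
  define S where "S = 2 powr (q + 1)"
  have S: "0 < S" by (simp add: S_def)
  have "q * (2 * b1) powr (- q - 1) * (b2 - b0) \<le> b0 powr (- q) - b2 powr (- q)"
  proof (cases "b0 < b2")
    case lt: True
    have "((\<lambda>x. x powr (- q)) has_real_derivative (- q) * x powr (- q - 1)) (at x)" if "b0 \<le> x" for x
      using that assms by (auto intro!: derivative_eq_intros)
    then obtain z where z: "b0 < z" "z < b2"
        "b2 powr (- q) - b0 powr (- q) = (b2 - b0) * ((- q) * z powr (- q - 1))"
      using MVT2[OF lt, of "\<lambda>x. x powr (- q)" "\<lambda>x. (- q) * x powr (- q - 1)"] by blast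
    \<comment> \<open>The intermediate point satisfies z < b2 \<le> 2 b1; this is what the case
      distinction buys.\<close>
    have "(2 * b1) powr (- q - 1) \<le> z powr (- q - 1)"
      using z True assms by (intro powr_mono2') auto
    then have "q * (2 * b1) powr (- q - 1) * (b2 - b0) \<le> q * z powr (- q - 1) * (b2 - b0)"
      using assms lt by (intro mult_right_mono mult_left_mono) auto
    then show ?thesis using z(3) by (simp add: algebra_simps)
  next
    case False
    then have "b0 = b2" using assms by simp
    then show ?thesis by simp
  qed
  moreover have "(2 * b1) powr (- q - 1) = b1 powr (- q - 1) / S"
    using powr_minus_divide[of 2 "q + 1"] by (simp add: powr_mult S_def)
  ultimately have "q * (b1 powr (- q - 1) / S) * (b2 - b0) \<le> b0 powr (- q) - b2 powr (- q)"
    by (simp only:)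
  then have "(b2 - b0) * b1 powr (- q - 1) \<le> S / q * (b0 powr (- q) - b2 powr (- q))"
    using assms(1) S by (simp add: field_simps)
  then have "(b2 - b0) * b1 powr (- q - 1) \<le> 2 powr (q + 1) / q * (b0 powr (- q) - b2 powr (- q))"
    by (simp only: S_def)
  moreover have "min b1 (b2 - b0) * b1 powr (- q - 1) \<le> (b2 - b0) * b1 powr (- q - 1)"
    by (intro mult_right_mono) auto
  moreover have "b2 powr (- q) \<le> b0 powr (- q)" using assms by (intro powr_mono2') auto
  then have "2 powr (q + 1) / q * (b0 powr (- q) - b2 powr (- q))
    \<le> max (2 powr (q + 1) / q) (1 / (1 - 2 powr (- q))) * (b0 powr (- q) - b2 powr (- q))"
    by (intro mult_right_mono) auto
  ultimately show ?thesis by linarith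
next
  case False
  have two: "2 powr (- q) < 1" using assms(1) by (simp add: powr_less_one)
  have "b2 powr (- q) \<le> (2 * b1) powr (- q)" using False assms by (intro powr_mono2') auto
  then have "b2 powr (- q) \<le> 2 powr (- q) * b1 powr (- q)" by (simp add: powr_mult)
  moreover have "b1 powr (- q) \<le> b0 powr (- q)" using assms by (intro powr_mono2') auto
  ultimately have *: "(1 - 2 powr (- q)) * b1 powr (- q) \<le> b0 powr (- q) - b2 powr (- q)"
    by (simp add: algebra_simps)
  have "min b1 (b2 - b0) * b1 powr (- q - 1) \<le> b1 * b1 powr (- q - 1)"
    by (intro mult_right_mono) auto
  also have "\<dots> = b1 powr (- q)" using assms by (simp add: powr_diff)
  also have "\<dots> \<le> 1 / (1 - 2 powr (- q)) * (b0 powr (- q) - b2 powr (- q))"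
    using * two by (simp add: field_simps)
  also have "b2 powr (- q) \<le> b0 powr (- q)" using assms by (intro powr_mono2') auto
  then have "1 / (1 - 2 powr (- q)) * (b0 powr (- q) - b2 powr (- q))
    \<le> max (2 powr (q + 1) / q) (1 / (1 - 2 powr (- q))) * (b0 powr (- q) - b2 powr (- q))"
    by (intro mult_right_mono) auto
  finally show ?thesis .
qed

text \<open>A discrete form of the blow-up of b' \<ge> x b^p: dividing by b^p and summing bounds the
  sum of \<open>x\<close> by a telescoping sum in b^(1 - p). An increment bound alone would not
  suffice, since \<open>b\<close> may jump by an arbitrarily large factor; the other entry of
  \<open>min\<close> covers such jumps.\<close>

lemma summable_of_superlinear_growth:
  fixes b x :: "nat \<Rightarrow> real"
  assumes "1 < p" "0 < C" and b: "0 < b 0" "\<And>k. b k \<le> b (Suc k)" and x: "\<And>k. 0 \<le> x k"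
    and growth: "\<And>k. C * b (Suc k) powr p * x k \<le> min (b (Suc k)) (b (Suc (Suc k)) - b k)"
  shows "summable x"
proof -
  define q where "q = p - 1"
  have q: "0 < q" using assms(1) by (simp add: q_def)
  define A where "A = max (2 powr (q + 1) / q) (1 / (1 - 2 powr (- q)))"
  have b_pos: "0 < b k" for k by (induction k) (use b in \<open>auto intro: order_less_le_trans\<close>)
  define e where "e k = b k powr (- q)" for k
  have e_nonneg: "0 \<le> e k" for k by (simp add: e_def)
  have x_le: "C * x k \<le> A * (e k - e (Suc (Suc k)))" for k
  proof -
    have "C * x k = (C * b (Suc k) powr p * x k) * b (Suc k) powr (- q - 1)"
      using b_pos[of "Suc k"] by (simp add: q_def powr_minus field_simps)
    also have "\<dots> \<le> min (b (Suc k)) (b (Suc (Suc k)) - b k) * b (Suc k) powr (- q - 1)"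
      by (intro mult_right_mono growth) simp
    also have "\<dots> \<le> A * (e k - e (Suc (Suc k)))"
      unfolding A_def e_def by (intro power_drop q b b_pos)
    finally show ?thesis .
  qed
  have A: "0 \<le> A" using q by (simp add: A_def le_max_iff_disj)
  have sum_le: "(\<Sum>k<n. C * x k) \<le> A * (e 0 + e 1)" for n
  proof -
    \<comment> \<open>The two-step difference e_k - e_(k+2) is the one-step difference of e_k +
      e_(k+1), which telescopes.\<close>
    have "(\<Sum>k<n. C * x k) \<le> (\<Sum>k<n. A * ((e k + e (Suc k)) - (e (Suc k) + e (Suc (Suc k)))))"
      using x_le by (intro sum_mono) (simp add: algebra_simps)
    also have "\<dots> = A * (e 0 + e 1 - (e n + e (Suc n)))"
      unfolding sum_distrib_left[symmetric]
      using sum_lessThan_telescope'[of "\<lambda>k. e k + e (Suc k)" n] by simp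
    also have "\<dots> \<le> A * (e 0 + e 1)"
      using e_nonneg[of n] e_nonneg[of "Suc n"] by (intro mult_left_mono A) linarith
    finally show ?thesis .
  qed
  have "summable (\<lambda>k. C * x k)"
  proof (rule bounded_imp_summable)
    show "(\<Sum>k\<le>n. C * x k) \<le> A * (e 0 + e 1)" for n
      using sum_le[of "Suc n"] by (simp only: lessThan_Suc_atMost)
  qed (use x assms(2) in simp)
  then show ?thesis using assms(2) by simp
qed

text \<open>Condensation on the cells between successive points a q^k: by monotonicity each cell
  contributes at most a fixed multiple of the value of \<mu> at its right end.\<close>

lemma dini_integral_finite:
  fixes \<mu> :: "real \<Rightarrow> real"
  assumes mono: "mono_on {0..} \<mu>" and nonneg: "\<And>s. 0 \<le> s \<Longrightarrow> 0 \<le> \<mu> s"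
    and a: "0 < a" and q: "0 < q" "q < 1" and sum: "summable (\<lambda>k. \<mu> (a * q ^ k))"
  shows "(\<integral>\<^sup>+ s\<in>{0<..a}. ennreal (\<mu> s / s) \<partial>lborel) < \<infinity>"
proof -
  define s where "s k = a * q ^ k" for k
  have s_pos: "0 < s k" for k using a q by (simp add: s_def)
  have s_dec: "s (Suc k) = q * s k" for k by (simp add: s_def)
  define f where "f k t = ennreal (\<mu> (s k) / s (Suc k)) * indicator {s (Suc k)<..s k} t" for k t
  have "ennreal (\<mu> t / t) * indicator {0<..a} t \<le> (\<Sum>k. f k t)" for t
  proof (cases "t \<in> {0<..a}")
    case True
    obtain N where "q ^ N < t / a"
      using real_arch_pow_inv[of "t / a" q] True q a by auto
    then have ex: "\<exists>k. s k < t" using a by (intro exI[of _ N]) (simp add: s_def field_simps)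
    \<comment> \<open>Locates the cell of \<open>t\<close>. The index is positive because t \<le> a
      = s 0, so it has a predecessor whose point is at least \<open>t\<close>.\<close>
    define n where "n = (LEAST k. s k < t)"
    have n: "s n < t" unfolding n_def by (rule LeastI_ex[OF ex])
    have "n \<noteq> 0" using n True by (cases n) (auto simp: s_def)
    then obtain k where k: "n = Suc k" by (cases n) auto
    then have "\<not> s k < t" using not_less_Least[of k "\<lambda>k. s k < t"] by (simp add: n_def)
    then have t: "s (Suc k) < t" "t \<le> s k" using n k by auto
    have "\<mu> t \<le> \<mu> (s k)" using mono_onD[OF mono, of t "s k"] t True by simp
    then have "\<mu> t / t \<le> \<mu> (s k) / s (Suc k)"
      using t s_pos[of "Suc k"] nonneg[of t] nonneg[of "s k"] s_pos[of k] True by (intro frac_le) auto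
    then have "ennreal (\<mu> t / t) \<le> f k t" using t by (simp add: f_def ennreal_leI)
    also have "\<dots> \<le> (\<Sum>k. f k t)"
      using sum_le_suminf[of "\<lambda>k. f k t" "{k}"] by simp
    finally show ?thesis using True by simp
  qed simp
  then have "(\<integral>\<^sup>+ s\<in>{0<..a}. ennreal (\<mu> s / s) \<partial>lborel) \<le> (\<integral>\<^sup>+ t. (\<Sum>k. f k t) \<partial>lborel)"
    by (intro nn_integral_mono) simp
  also have "\<dots> = (\<Sum>k. \<integral>\<^sup>+ t. f k t \<partial>lborel)"
    by (rule nn_integral_suminf) (simp add: f_def)
  also have "\<dots> = (\<Sum>k. ennreal ((1 / q - 1) * \<mu> (s k)))"
  proof (rule suminf_cong)
    fix k
    have "(\<integral>\<^sup>+ t. f k t \<partial>lborel) = ennreal (\<mu> (s k) / s (Suc k)) * ennreal (s k - s (Suc k))"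
      using q s_pos[of k] unfolding f_def
      by (subst nn_integral_cmult_indicator) (auto simp: s_dec mult_left_le_one_le)
    also have "\<dots> = ennreal (\<mu> (s k) / s (Suc k) * (s k - s (Suc k)))"
      using nonneg[of "s k"] s_pos[of k] s_pos[of "Suc k"] by (intro ennreal_mult''[symmetric]) (use q in \<open>simp add: s_dec mult_left_le_one_le\<close>)
    \<comment> \<open>Cell length (1 - q) s_k over left endpoint q s_k is the same for all
      \<open>k\<close>.\<close>
    also have "\<mu> (s k) / s (Suc k) * (s k - s (Suc k)) = (1 / q - 1) * \<mu> (s k)"
      using q s_pos[of k] by (simp add: s_dec field_simps)
    finally show "(\<integral>\<^sup>+ t. f k t \<partial>lborel) = ennreal ((1 / q - 1) * \<mu> (s k))" .
  qed
  also have "\<dots> = ennreal (\<Sum>k. (1 / q - 1) * \<mu> (s k))"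
    using q nonneg s_pos sum
    by (intro suminf_ennreal_eq[symmetric, THEN sym] summable_sums summable_mult)
       (auto simp: s_def less_imp_le)
  also have "\<dots> < \<infinity>" by simp
  finally show ?thesis .
qed

section \<open>The estimate at a single scale\<close>

text \<open>Takes the place of Jensen's inequality: for any \<open>s > 0\<close>, the function
  \<open>v\<^sup>p \<mu>(v)\<close> lies above the line \<open>(v - s) s\<^sup>p\<^sup>-\<^sup>1 \<mu>(s)\<close>. It is used with \<open>s\<close> half the mean value of \<open>v\<close>.\<close>

lemma mean_value_bound:
  fixes v h :: "'a \<Rightarrow> real" and \<mu> :: "real \<Rightarrow> real"
  assumes p: "1 < p" and mono: "mono_on {0..} \<mu>" and nonneg: "\<And>s. 0 \<le> s \<Longrightarrow> 0 \<le> \<mu> s"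
    and D: "D \<in> sets M" "emeasure M D < \<infinity>"
    and v: "integrable M v" "\<And>z. 0 \<le> v z" "\<And>z. z \<notin> D \<Longrightarrow> v z = 0"
    and h: "integrable M h" "\<And>z. v z powr p * \<mu> (v z) \<le> h z"
    and s: "0 < s" "2 * s * measure M D \<le> (\<integral>z. v z \<partial>M)"
  shows "s powr p * \<mu> s * measure M D \<le> (\<integral>z. h z \<partial>M)"
proof -
  define a where "a = s powr (p - 1) * \<mu> s"
  have a: "0 \<le> a" using nonneg[of s] s by (simp add: a_def)
  have int: "integrable M (\<lambda>z. (v z - s * indicator D z) * a)"
    using v(1) D by (intro integrable_mult_left Bochner_Integration.integrable_diff integrable_mult_right
        integrable_real_indicator) auto
  have "s powr p * \<mu> s * measure M D = (2 * s * measure M D - s * measure M D) * a"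
    using s by (simp add: a_def powr_diff)
  also have "\<dots> \<le> ((\<integral>z. v z \<partial>M) - s * measure M D) * a"
    using s a by (intro mult_right_mono) auto
  also have "\<dots> = (\<integral>z. (v z - s * indicator D z) * a \<partial>M)"
    using v(1) D by simp
  also have "\<dots> \<le> (\<integral>z. h z \<partial>M)"
  proof (rule integral_mono[OF int h(1)])
    fix z
    have h0: "0 \<le> h z" using h(2)[of z] nonneg[OF v(2)[of z]] by (meson mult_nonneg_nonneg order_trans powr_ge_zero)
    show "(v z - s * indicator D z) * a \<le> h z"
    \<comment> \<open>Above level \<open>s\<close>, discard the subtracted \<open>s\<close> and use
      that v^(p - 1) and \<mu>(v) only increase; elsewhere the line is nonpositive.\<close>
    proof (cases "z \<in> D \<and> s < v z")
      case True
      have "(v z - s * indicator D z) * a \<le> v z * a" using s a by (intro mult_right_mono) (auto simp: indicator_def)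
      also have "\<dots> \<le> v z * (v z powr (p - 1) * \<mu> (v z))"
        unfolding a_def using True s p nonneg mono_onD[OF mono, of s "v z"]
        by (intro mult_left_mono mult_mono powr_mono2) auto
      also have "\<dots> = v z powr p * \<mu> (v z)" using True s by (simp add: powr_diff)
      finally show ?thesis using h(2)[of z] by linarith
    next
      case False
      then have "(v z - s * indicator D z) * a \<le> 0"
        using v(3)[of z] a s by (auto simp: indicator_def intro!: mult_nonpos_nonneg)
      then show ?thesis using h0 by linarith
    qed
  qed
  finally show ?thesis .
qed

lemma measure_time_space_box:
  fixes a b :: real
  assumes "0 \<le> a" "0 \<le> b"
  shows "measure lborel ({0..a} \<times> cbox (\<chi> i. - b) (\<chi> i. b) :: (real \<times> (real^'n::finite)) set)
           = a * (2 * b) ^ CARD('n)"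
proof -
  have "cbox (\<chi> i. - b) (\<chi> i. b) \<noteq> ({} :: (real^'n) set)"
    using assms by (auto simp: interval_ne_empty_cart)
  then have "measure lborel (cbox (\<chi> i. - b) (\<chi> i. b) :: (real^'n) set) = (2 * b) ^ CARD('n)"
    by (simp add: content_cbox_cart)
  then show ?thesis
    using assms content_Pair[of "0::real" "\<chi> i. - b" a "\<chi> i::'n. b"] by (simp add: cbox_Pair_eq)
qed

text \<open>The constants come before \<open>R\<close> and \<open>\<delta>\<close>, so the estimate
  can be summed over scales. Integrability against \<open>outer_part\<close> is part of the
  conclusion because later comparisons of these integrals require it.\<close>

lemma single_scale_estimate:
  fixes d :: "nat \<Rightarrow> nat" and c :: "nat \<Rightarrow> ('n::finite \<Rightarrow> nat) \<Rightarrow> real"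
    and \<mu> F :: "real \<Rightarrow> real" and u0 :: "nat \<Rightarrow> real^'n \<Rightarrow> real" and w :: "real \<times> (real^'n) \<Rightarrow> real"
  defines "N \<equiv> real CARD('n)"
  assumes X: "cutoff p M K X" and p: "1 < p" and M: "m \<le> M" "\<And>j. j \<le> m \<Longrightarrow> d j \<le> M" and l: "l \<le> m"
    and \<eta>: "0 < \<eta>" and g: "0 < crit_g m d c l \<eta>"
    and scale: "p * (N + \<eta> - crit_g m d c l \<eta>) = N + \<eta>"
    and mono: "mono_on {0..} \<mu>" and nonneg: "\<And>s. 0 \<le> s \<Longrightarrow> 0 \<le> \<mu> s"
    and F: "F = (\<lambda>s. \<bar>s\<bar> powr p * \<mu> \<bar>s\<bar>)"
    and w: "Lp_loc (cylinder \<infinity>) p w"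
  shows "\<exists>C1>0. \<exists>C2>0. \<forall>R\<ge>1. \<forall>\<delta>>0.
    weak_identity \<infinity> m d c l F u0 w (bump X (R powr \<eta>) R) \<longrightarrow>
    \<delta> \<le> (\<Sum>j=l..<m. LBINT x. u0 j x * adjoint_op d c (j + 1) (\<lambda>y. bump X (R powr \<eta>) R (0, y)) x) \<longrightarrow>
    set_integrable lborel (cylinder \<infinity>) (\<lambda>z. F (w z) * outer_part X (R powr \<eta>) R z) \<and>
    C1 * ((LBINT z:cylinder \<infinity>. F (w z) * bump X (R powr \<eta>) R z) + \<delta>) powr p *
        \<mu> (C2 * \<delta> * R powr (- (N + \<eta> - crit_g m d c l \<eta>)))
      \<le> (LBINT z:cylinder \<infinity>. F (w z) * outer_part X (R powr \<eta>) R z)"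
proof -
  let ?cyl = "cylinder \<infinity> :: (real \<times> (real^'n)) set"
  define g0 where "g0 = crit_g m d c l \<eta>"
  define \<kappa> where "\<kappa> = N + \<eta> - g0"
  define adj where "adj j R z = adjoint_op d c j
      (\<lambda>y. time_deriv \<infinity> (int j - int l) (bump X (R powr \<eta>) R) (fst z, y)) (snd z)" for j R z
  have cyl: "z \<in> ?cyl \<longleftrightarrow> 0 \<le> fst z" for z by (cases z) (simp add: cylinder_def time_interval_def)
  have "\<forall>j\<in>{0..m}. \<exists>C\<ge>0. \<forall>R\<ge>1. \<forall>t\<ge>0. \<forall>x. \<bar>adj j R (t, x)\<bar>
      \<le> C * R powr (- g0) * outer_part X (R powr \<eta>) R (t, x) powr (1 / p)"
    unfolding adj_def g0_def fst_conv snd_conv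
    using adjoint_op_bump_le[OF X p M(1) M(2) _ l \<eta> g] by auto
  then obtain Cj where Cj: "\<And>j. j \<in> {0..m} \<Longrightarrow> 0 \<le> Cj j"
    "\<And>j R z. \<lbrakk>j \<in> {0..m}; 1 \<le> R; z \<in> ?cyl\<rbrakk> \<Longrightarrow> \<bar>adj j R z\<bar>
      \<le> Cj j * R powr (- g0) * outer_part X (R powr \<eta>) R z powr (1 / p)"
    unfolding bchoice_iff cyl by (metis surjective_pairing)
  define C where "C = (\<Sum>j=0..m. Cj j) + 1"
  have C: "0 < C" unfolding C_def by (intro add_nonneg_pos sum_nonneg Cj(1)) auto
  define V1 :: real where "V1 = 2 * 4 ^ CARD('n)"
  have V1: "0 < V1" by (simp add: V1_def)
  \<comment> \<open>Collects the 2 required by \<open>mean_value_bound\<close>, the constant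
    \<open>C\<close> of the adjoint terms and the volume factor \<open>V1\<close>.\<close>
  define C2 where "C2 = 1 / (2 * C * V1)"
  have C2: "0 < C2" using C V1 by (simp add: C2_def)
  define C1 where "C1 = C2 powr p * V1"
  have C1: "0 < C1" using C2 V1 by (simp add: C1_def)
  have F_nonneg: "0 \<le> F s" for s using nonneg by (simp add: F)
  have w_meas [measurable]: "(\<lambda>z. indicator ?cyl z * w z) \<in> borel_measurable lborel"
    using w by (simp add: Lp_loc_def set_borel_measurable_def)
  show ?thesis
  proof (rule exI[of _ C1], rule conjI[OF C1], rule exI[of _ C2], rule conjI[OF C2], intro allI impI conjI)
    fix R \<delta> :: real assume R: "1 \<le> R" and \<delta>: "0 < \<delta>"
    define \<rho> where "\<rho> = R powr \<eta>"
    have \<rho>: "0 < \<rho>" using R by (simp add: \<rho>_def)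
    define \<psi> where "\<psi> = (bump X \<rho> R :: real \<times> (real^'n) \<Rightarrow> real)"
    define \<theta> where "\<theta> = (outer_part X \<rho> R :: real \<times> (real^'n) \<Rightarrow> real)"
    assume id: "weak_identity \<infinity> m d c l F u0 w (bump X (R powr \<eta>) R)"
      and data: "\<delta> \<le> (\<Sum>j=l..<m. LBINT x. u0 j x * adjoint_op d c (j + 1) (\<lambda>y. bump X (R powr \<eta>) R (0, y)) x)"
    have \<theta>_range: "0 \<le> \<theta> z" "\<theta> z \<le> 1" for z
      by (simp_all add: \<theta>_def outer_part_def bump_range[OF X])
    have inner_meas: "- inner_box \<rho> R \<in> sets (lborel :: (real \<times> (real^'n)) measure)"
      by (simp add: borel_comp borel_open open_inner_box)
    have "\<psi> \<in> borel_measurable lborel"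
      unfolding \<psi>_def using borel_measurable_continuous_onI[OF continuous_on_bump[OF cutoffD(1)[OF X]]] by simp
    moreover have \<theta>_eq: "\<theta> = (\<lambda>z. indicator (- inner_box \<rho> R) z * \<psi> z)"
      by (auto simp: \<theta>_def \<psi>_def outer_part_def indicator_def)
    ultimately have \<theta>_meas [measurable]: "\<theta> \<in> borel_measurable lborel"
      unfolding \<theta>_eq by (intro borel_measurable_times borel_measurable_indicator inner_meas)
    \<comment> \<open>Contains the support of the test function at times t \<ge> 0. Its compactness
      makes the local integrability of \<open>w\<close> applicable.\<close>
    define D :: "(real \<times> (real^'n)) set" where "D = {0..2 * \<rho>} \<times> cbox (\<chi> i. - (2 * R)) (\<chi> i. 2 * R)"
    have D_compact: "compact D" unfolding D_def by (intro compact_Times compact_cbox compact_Icc)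
    then have D_sets [measurable]: "D \<in> sets lborel" by (simp add: compact_imp_closed borel_closed)
    have emeasure_lborel_D: "emeasure lborel D < \<infinity>"
      using emeasure_compact_finite[OF D_compact] by simp
    have D_cyl: "D \<subseteq> ?cyl" by (auto simp: D_def cyl)
    have \<theta>_0: "\<theta> z = 0" if "z \<in> ?cyl" "z \<notin> D" for z
    proof -
      have "2 * \<rho> \<le> \<bar>fst z\<bar> \<or> (\<exists>i. 2 * R \<le> \<bar>snd z $ i\<bar>)"
      proof (rule ccontr)
        assume "\<not> ?thesis"
        then have "\<bar>fst z\<bar> < 2 * \<rho>" "\<And>i. \<bar>snd z $ i\<bar> < 2 * R" by (auto simp: not_le)
        then have "z \<in> D" using that(1)
          by (cases z) (auto simp: D_def cyl mem_box_cart abs_less_iff less_imp_le minus_le_iff)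
        then show False using that(2) by blast
      qed
      then have "bump X \<rho> R z = 0" using bump_eq_0[OF X \<rho>, of R z] R by auto
      then show ?thesis by (simp add: \<theta>_def outer_part_def)
    qed
    define V where "V = measure lborel D"
    have V: "V = V1 * R powr (N + \<eta>)"
    proof -
      have "V = 2 * \<rho> * (4 * R) ^ CARD('n)"
        using measure_time_space_box[of "2 * \<rho>" "2 * R", where 'n='n] R \<rho> by (simp add: V_def D_def)
      also have "\<dots> = V1 * (R powr N * R powr \<eta>)"
        using R by (simp add: V1_def power_mult_distrib \<rho>_def N_def powr_realpow)
      finally show ?thesis by (simp add: powr_add)
    qed
    define v where "v z = indicator ?cyl z * (\<bar>w z\<bar> * \<theta> z powr (1 / p))" for z
    define h where "h z = indicator ?cyl z * (F (w z) * \<theta> z)" for z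
    have v_nonneg: "0 \<le> v z" for z by (simp add: v_def)
    have v_out: "v z = 0" if "z \<notin> D" for z using that \<theta>_0 by (auto simp: v_def indicator_def)
    have v_le: "v z \<le> \<bar>w z\<bar>" for z
      using \<theta>_range[of z] p
      by (auto simp: v_def indicator_def intro!: mult_left_le powr_le1)
    have v_int: "integrable lborel v"
    proof (rule Bochner_Integration.integrable_bound)
      have "set_integrable lborel D (\<lambda>z. \<bar>w z\<bar> powr p)"
        using w D_compact D_cyl by (simp add: Lp_loc_def)
      moreover have "integrable lborel (indicator D :: _ \<Rightarrow> real)"
        by (intro integrable_real_indicator D_sets emeasure_lborel_D)
      ultimately show "integrable lborel (\<lambda>z. indicator D z + indicator D z * \<bar>w z\<bar> powr p)"
        unfolding set_integrable_def by (intro Bochner_Integration.integrable_add) auto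
      have "v = (\<lambda>z. \<bar>indicator ?cyl z * w z\<bar> * \<theta> z powr (1 / p))"
        by (auto simp: v_def abs_mult)
      then show "v \<in> borel_measurable lborel" by simp
      \<comment> \<open>Passes from p-th power integrability to integrability on the bounded set
        \<open>D\<close>.\<close>
      have w_le: "\<bar>w z\<bar> \<le> 1 + \<bar>w z\<bar> powr p" for z
      proof (cases "\<bar>w z\<bar> \<le> 1")
        case False
        then show ?thesis using powr_mono[of 1 p "\<bar>w z\<bar>"] p by simp
      qed (simp add: add_increasing2)
      have "norm (v z) \<le> norm (indicator D z + indicator D z * \<bar>w z\<bar> powr p)" for z
        using v_le[of z] v_nonneg[of z] v_out[of z] by (cases "z \<in> D") (auto intro: order_trans[OF _ w_le])
      then show "AE z in lborel. norm (v z) \<le> norm (indicator D z + indicator D z * \<bar>w z\<bar> powr p)" by simp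
    qed
    have F_int: "set_integrable lborel ?cyl (\<lambda>z. F (w z) * \<psi> z)"
      using id by (simp add: weak_identity_def \<psi>_def \<rho>_def)
    have h_int: "integrable lborel h"
    proof -
      have "integrable lborel (\<lambda>z. indicator (- inner_box \<rho> R) z *\<^sub>R (indicator ?cyl z *\<^sub>R (F (w z) * \<psi> z)))"
        using F_int unfolding set_integrable_def by (rule integrable_mult_indicator[OF inner_meas])
      moreover have "h = (\<lambda>z. indicator (- inner_box \<rho> R) z *\<^sub>R (indicator ?cyl z *\<^sub>R (F (w z) * \<psi> z)))"
        by (auto simp: h_def \<theta>_eq)
      ultimately show ?thesis by simp
    qed
    have h_eq: "(\<integral>z. h z \<partial>lborel) = (LBINT z:?cyl. F (w z) * outer_part X (R powr \<eta>) R z)"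
      by (simp add: h_def set_lebesgue_integral_def \<theta>_def \<rho>_def)
    \<comment> \<open>The p-th power turns the root of \<theta> back into \<theta>, and \<theta>
      \<le> 1 gives v \<le> |w|, hence \<mu>(v) \<le> \<mu>(|w|).\<close>
    have h_ge: "v z powr p * \<mu> (v z) \<le> h z" for z
    proof (cases "z \<in> ?cyl")
      case True
      have "v z powr p = \<bar>w z\<bar> powr p * \<theta> z"
        using True \<theta>_range[of z] p by (simp add: v_def powr_mult powr_powr)
      moreover have "\<mu> (v z) \<le> \<mu> \<bar>w z\<bar>" using mono_onD[OF mono, of "v z" "\<bar>w z\<bar>"] v_le v_nonneg by simp
      ultimately show ?thesis
        using True \<theta>_range[of z] by (simp add: h_def F mult_left_mono mult.assoc mult.left_commute[of "\<theta> z"])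
          (simp add: mult_left_mono mult.commute[of _ "\<theta> z"])
    qed (use p in \<open>simp add: v_def h_def\<close>)
    define a where "a = (LBINT z:?cyl. F (w z) * \<psi> z)"
    have a: "0 \<le> a"
      unfolding a_def set_lebesgue_integral_def using F_nonneg
      by (intro Bochner_Integration.integral_nonneg) (simp add: \<psi>_def bump_range[OF X])
    have adj_le: "\<bar>LBINT z:?cyl. w z * adj j R z\<bar> \<le> Cj j * R powr (- g0) * (\<integral>z. v z \<partial>lborel)"
      if j: "j \<in> {0..m}" for j
    proof -
      have "\<bar>LBINT z:?cyl. w z * adj j R z\<bar> \<le> (\<integral>z. Cj j * R powr (- g0) * v z \<partial>lborel)"
        unfolding set_lebesgue_integral_def
      proof (rule abs_integral_le)
        fix z
        show "\<bar>indicator ?cyl z *\<^sub>R (w z * adj j R z)\<bar> \<le> Cj j * R powr (- g0) * v z"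
        proof (cases "z \<in> ?cyl")
          case True
          have "\<bar>w z\<bar> * \<bar>adj j R z\<bar> \<le> \<bar>w z\<bar> * (Cj j * R powr (- g0) * \<theta> z powr (1 / p))"
            using Cj(2)[OF j R True] by (intro mult_left_mono) (auto simp: \<theta>_def \<rho>_def)
          then show ?thesis using True by (simp add: v_def abs_mult mult.commute mult.left_commute)
        qed (simp add: v_def)
      qed (use v_int in simp)
      then show ?thesis by simp
    qed
    \<comment> \<open>The data sum has a minus sign in the weak identity; moved to the left it
      contributes at least \<open>\<delta>\<close>.\<close>
    have "a + \<delta> \<le> (\<Sum>j=0..m. (- 1) powi (int j - int l) * (LBINT z:?cyl. w z * adj j R z))"
      using id data unfolding weak_identity_def a_def \<psi>_def \<rho>_def adj_def by linarith
    also have "\<dots> \<le> (\<Sum>j=0..m. Cj j * R powr (- g0) * (\<integral>z. v z \<partial>lborel))"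
    proof (rule sum_mono)
      fix j assume j: "j \<in> {0..m}"
      have "\<bar>(- 1) powi (int j - int l) * (LBINT z:?cyl. w z * adj j R z)\<bar> = \<bar>LBINT z:?cyl. w z * adj j R z\<bar>"
        by (simp add: abs_mult power_int_abs)
      then show "(- 1) powi (int j - int l) * (LBINT z:?cyl. w z * adj j R z)
          \<le> Cj j * R powr (- g0) * (\<integral>z. v z \<partial>lborel)"
        using adj_le[OF j] by linarith
    qed
    also have "\<dots> = (\<Sum>j=0..m. Cj j) * (R powr (- g0) * (\<integral>z. v z \<partial>lborel))"
      by (simp add: sum_distrib_right mult.assoc)
    also have "\<dots> \<le> C * (R powr (- g0) * (\<integral>z. v z \<partial>lborel))"
      using v_nonneg by (intro mult_right_mono) (auto simp: C_def)
    finally have av: "a + \<delta> \<le> C * (R powr (- g0) * (\<integral>z. v z \<partial>lborel))" .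
    define s where "s = C2 * (a + \<delta>) * R powr (- \<kappa>)"
    have s: "0 < s" using C2 a \<delta> R by (simp add: s_def)
    have "s powr p * \<mu> s * measure lborel D \<le> (\<integral>z. h z \<partial>lborel)"
    proof (rule mean_value_bound[OF p mono nonneg D_sets emeasure_lborel_D v_int v_nonneg v_out h_int h_ge s])
      have "2 * s * V = (a + \<delta>) / C * (R powr (- \<kappa>) * R powr (N + \<eta>))"
        using C V1 by (simp add: s_def V C2_def field_simps)
      also have "R powr (- \<kappa>) * R powr (N + \<eta>) = R powr g0" by (simp add: \<kappa>_def flip: powr_add)
      also have "(a + \<delta>) / C \<le> R powr (- g0) * (\<integral>z. v z \<partial>lborel)"
        using av C by (simp add: field_simps)
      also have "R powr (- g0) * (\<integral>z. v z \<partial>lborel) * R powr g0 = (\<integral>z. v z \<partial>lborel)"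
        using R by (simp add: powr_minus)
      finally show "2 * s * measure lborel D \<le> (\<integral>z. v z \<partial>lborel)" by (simp add: V_def mult_right_mono)
    qed
    moreover have "s powr p * measure lborel D = C1 * (a + \<delta>) powr p"
    proof -
      have "s powr p = C2 powr p * (a + \<delta>) powr p * R powr (- (p * \<kappa>))"
        using C2 a \<delta> by (simp add: s_def powr_mult powr_powr mult.commute)
      \<comment> \<open>Criticality: the powers of \<open>R\<close> cancel exactly.\<close>
      moreover have "R powr (- (p * \<kappa>)) * R powr (N + \<eta>) = 1"
        using scale R by (simp add: \<kappa>_def g0_def flip: powr_add)
      ultimately show ?thesis by (simp add: C1_def V[unfolded V_def])
    qed
    ultimately have main: "C1 * (a + \<delta>) powr p * \<mu> s \<le> (\<integral>z. h z \<partial>lborel)"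
      by (simp add: mult.commute mult.left_commute)
    \<comment> \<open>Dropping \<open>a\<close> makes the argument of \<mu> an explicit power of
      \<open>R\<close>, independent of the solution.\<close>
    have "\<mu> (C2 * \<delta> * R powr (- \<kappa>)) \<le> \<mu> s"
      using a \<delta> C2 s by (intro mono_onD[OF mono]) (auto simp: s_def intro!: mult_right_mono mult_left_mono)
    then have "C1 * (a + \<delta>) powr p * \<mu> (C2 * \<delta> * R powr (- \<kappa>)) \<le> C1 * (a + \<delta>) powr p * \<mu> s"
      using C1 by (intro mult_left_mono) auto
    with main show "C1 * ((LBINT z:?cyl. F (w z) * bump X (R powr \<eta>) R z) + \<delta>) powr p *
        \<mu> (C2 * \<delta> * R powr (- (N + \<eta> - crit_g m d c l \<eta>)))
      \<le> (LBINT z:?cyl. F (w z) * outer_part X (R powr \<eta>) R z)"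
      unfolding h_eq a_def \<psi>_def \<rho>_def \<kappa>_def g0_def by linarith
    show "set_integrable lborel ?cyl (\<lambda>z. F (w z) * outer_part X (R powr \<eta>) R z)"
      using h_int unfolding h_def[abs_def] set_integrable_def \<theta>_def \<rho>_def by simp
  qed
qed

section \<open>Summation over a geometric sequence of scales\<close>

theorem theorem2p2:
  fixes m l :: nat
    and d :: "nat \<Rightarrow> nat"
    and c :: "nat \<Rightarrow> ('n::finite \<Rightarrow> nat) \<Rightarrow> real"
    and p_c :: real
    and \<mu> F :: "real \<Rightarrow> real"
    and u0 :: "nat \<Rightarrow> real^'n \<Rightarrow> real"
  assumes "1 \<le> m" and "l < m"
    and "normalized_operator m d c"
    and "crit_exponent m d c l = ereal p_c" and "1 < p_c"
    and "\<And>s. 0 \<le> s \<Longrightarrow> 0 \<le> \<mu> s"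
    and "mono_on {0..} \<mu>"
    and "\<exists>\<epsilon>>0. bounded (\<mu> ` {0..\<epsilon>})"
    and F_def: "F = (\<lambda>s. \<bar>s\<bar> powr p_c * \<mu> \<bar>s\<bar>)"
    and "convex_on UNIV F"
    and "\<And>j. j < l \<Longrightarrow> AE x in lborel. u0 j x = 0"
    and "\<And>j. l \<le> j \<Longrightarrow> j < m \<Longrightarrow> integrable lborel (u0 j)"
    and "0 < (\<Sum>j | l \<le> j \<and> j < m \<and> c (j + 1) (\<lambda>_. 0) \<noteq> 0.
                c (j + 1) (\<lambda>_. 0) * (LBINT x. u0 j x))"
    and "\<exists>u. weak_solution \<infinity> m d c l p_c F u0 u"
  shows "\<exists>c0>0. (\<integral>\<^sup>+ s\<in>{0<..c0}. ennreal (\<mu> s / s) \<partial>lborel) < \<infinity>"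
proof -
  define N where "N = real CARD('n)"
  obtain \<eta> where \<eta>: "0 < \<eta>" "0 < crit_g m d c l \<eta>" "crit_g m d c l \<eta> < N + \<eta>"
    "p_c * (N + \<eta> - crit_g m d c l \<eta>) = N + \<eta>"
    using critical_scale_exists[OF assms(3-5)] unfolding N_def by blast
  define \<kappa> where "\<kappa> = N + \<eta> - crit_g m d c l \<eta>"
  have \<kappa>: "0 < \<kappa>" using \<eta>(3) by (simp add: \<kappa>_def)
  define M where "M = m + (\<Sum>j\<le>m. d j)"
  have M: "m \<le> M" "\<And>j. j \<le> m \<Longrightarrow> d j \<le> M"
    by (auto simp: M_def intro: trans_le_add2 member_le_sum)
  obtain X K where X: "cutoff p_c M K X"
    using cutoff_exists[OF \<open>1 < p_c\<close>, of M] by blast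
  obtain w where w: "Lp_loc (cylinder \<infinity>) p_c w"
    and id: "\<And>\<psi>. test_fun \<infinity> \<psi> \<Longrightarrow> one_near_origin \<psi> \<Longrightarrow> weak_identity \<infinity> m d c l F u0 w \<psi>"
    using assms(14) unfolding weak_solution_def by blast
  \<comment> \<open>Both r and r^\<eta> are at least 2, so the support of one test function, which
    extends to twice its scale, fits into the box where the next one is 1.\<close>
  define r where "r = max 2 (2 powr (1 / \<eta>))"
  have r: "2 \<le> r" by (simp add: r_def)
  have r_time: "2 \<le> r powr \<eta>"
  proof -
    have "2 = (2 powr (1 / \<eta>)) powr \<eta>" using \<eta>(1) by (simp add: powr_powr)
    also have "\<dots> \<le> r powr \<eta>" using \<eta>(1) by (intro powr_mono2) (auto simp: r_def)
    finally show ?thesis .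
  qed
  define data where "data R = (\<Sum>j=l..<m. LBINT x. u0 j x *
      adjoint_op d c (j + 1) (\<lambda>y. bump X (R powr \<eta>) R (0, y)) x)" for R
  define S where "S = (\<Sum>j=l..<m. c (j + 1) (\<lambda>_. 0) * (LBINT x. u0 j x))"
  have "S = (\<Sum>j | l \<le> j \<and> j < m \<and> c (j + 1) (\<lambda>_. 0) \<noteq> 0. c (j + 1) (\<lambda>_. 0) * (LBINT x. u0 j x))"
    unfolding S_def by (rule sum.mono_neutral_right) auto
  then have S: "0 < S" using assms(13) by simp
  have "(\<lambda>k. data (r ^ k)) \<longlonglongrightarrow> S"
    unfolding data_def S_def
  proof (intro tendsto_sum data_term_tendsto[OF \<open>1 < p_c\<close> X])
    show "filterlim (\<lambda>k. r ^ k) at_top sequentially"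
      by (rule filterlim_at_infinity_imp_filterlim_at_top[OF filterlim_realpow_sequentially_gt1])
         (use r in auto)
  qed (use r M(2) assms(12) in auto)
  then have "\<forall>\<^sub>F k in sequentially. S / 2 < data (r ^ k)"
    by (rule order_tendstoD) (use S in simp)
  then obtain k0 where k0: "\<And>k. k0 \<le> k \<Longrightarrow> S / 2 < data (r ^ k)"
    by (auto simp: eventually_sequentially)
  \<comment> \<open>The shift by \<open>k0\<close> starts the sequence where the data terms already
    exceed half of their limit.\<close>
  define R where "R k = r ^ (k + k0)" for k
  have R1: "1 \<le> R k" for k using r by (simp add: R_def one_le_power)
  have R_pos: "0 < R k" "0 < R k powr \<eta>" for k using R1[of k] by auto
  have R_Suc: "2 * R k \<le> R (Suc k)" for k
    using r R_pos[of k] by (simp add: R_def)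
  have R_Suc_time: "2 * R k powr \<eta> \<le> R (Suc k) powr \<eta>" for k
  proof -
    have "R (Suc k) powr \<eta> = r powr \<eta> * R k powr \<eta>" by (simp add: R_def powr_mult)
    then show ?thesis using r_time by (simp add: mult_right_mono)
  qed
  define \<psi> where "\<psi> k = (bump X (R k powr \<eta>) (R k) :: real \<times> (real^'n) \<Rightarrow> real)" for k
  define \<theta> where "\<theta> k = (outer_part X (R k powr \<eta>) (R k) :: real \<times> (real^'n) \<Rightarrow> real)" for k
  have \<psi>_range: "0 \<le> \<psi> k z" "\<psi> k z \<le> 1" for k z
    by (simp_all add: \<psi>_def bump_range[OF X])
  have \<psi>_Suc_1: "\<psi> (Suc k) z = 1" if "\<psi> k z \<noteq> 0" for k z
  proof -
    have "\<not> (2 * R k powr \<eta> \<le> \<bar>fst z\<bar> \<or> 2 * R k \<le> \<bar>snd z $ i\<bar>)" for i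
      using bump_eq_0[OF X R_pos(2,1)[of k], of z i] that by (auto simp: \<psi>_def)
    then show ?thesis
      unfolding \<psi>_def using R_Suc[of k] R_Suc_time[of k]
      by (intro bump_eq_1[OF X R_pos(2,1)]) (auto simp: not_le intro: less_imp_le order_less_le_trans)
  qed
  have \<psi>_inner: "z \<in> inner_box (R (Suc k) powr \<eta>) (R (Suc k))" if "\<psi> k z \<noteq> 0" for k z
  proof -
    have "\<not> (2 * R k powr \<eta> \<le> \<bar>fst z\<bar> \<or> 2 * R k \<le> \<bar>snd z $ i\<bar>)" for i
      using bump_eq_0[OF X R_pos(2,1)[of k], of z i] that by (auto simp: \<psi>_def)
    then show ?thesis
      using R_Suc[of k] R_Suc_time[of k]
      by (auto simp: inner_box_def not_le intro: order_less_le_trans)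
  qed
  have \<psi>_mono: "\<psi> k z \<le> \<psi> (Suc k) z" for k z
    using \<psi>_Suc_1[of k z] \<psi>_range[of k z] \<psi>_range[of "Suc k" z] by (cases "\<psi> k z = 0") auto
  have \<theta>_le: "\<theta> k z \<le> \<psi> k z" for k z
    using \<psi>_range[of k z] by (simp add: \<theta>_def outer_part_def \<psi>_def)
  \<comment> \<open>At each point at most one summand is nonzero, because the support of the earlier
    test function lies in the box removed from the later one.\<close>
  have \<theta>_gap: "\<theta> (Suc k) z + \<psi> k z \<le> \<psi> (Suc (Suc k)) z" for k z
  proof (cases "\<psi> k z = 0")
    case True
    then show ?thesis using \<theta>_le[of "Suc k" z] \<psi>_mono[of "Suc k" z] by simp
  next
    case False
    then have "\<theta> (Suc k) z = 0" using \<psi>_inner by (simp add: \<theta>_def outer_part_def)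
    then show ?thesis using \<psi>_mono[of k z] \<psi>_mono[of "Suc k" z] by simp
  qed
  have identity: "weak_identity \<infinity> m d c l F u0 w (\<psi> k)" for k
    unfolding \<psi>_def by (intro id test_fun_bump[OF X] one_near_origin_bump[OF X] R_pos)
  have F_nonneg: "0 \<le> F s" for s using assms(6) by (simp add: F_def)
  have \<psi>_int: "set_integrable lborel (cylinder \<infinity>) (\<lambda>z. F (w z) * \<psi> k z)" for k
    using identity by (simp add: weak_identity_def)
  obtain C1 C2 where C1: "0 < C1" and C2: "0 < C2" and est:
    "\<And>R \<delta>. \<lbrakk>1 \<le> R; 0 < \<delta>; weak_identity \<infinity> m d c l F u0 w (bump X (R powr \<eta>) R); \<delta> \<le> data R\<rbrakk> \<Longrightarrow>
      set_integrable lborel (cylinder \<infinity>) (\<lambda>z. F (w z) * outer_part X (R powr \<eta>) R z) \<and>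
      C1 * ((LBINT z:cylinder \<infinity>. F (w z) * bump X (R powr \<eta>) R z) + \<delta>) powr p_c * \<mu> (C2 * \<delta> * R powr - \<kappa>)
      \<le> (LBINT z:cylinder \<infinity>. F (w z) * outer_part X (R powr \<eta>) R z)"
    using single_scale_estimate[OF X \<open>1 < p_c\<close> M less_imp_le[OF \<open>l < m\<close>] \<eta>(1,2) \<eta>(4)[unfolded N_def]
        assms(7,6) F_def w, of u0, folded N_def]
    unfolding data_def \<kappa>_def by blast
  define \<delta> where "\<delta> = S / 2"
  have \<delta>: "0 < \<delta>" using S by (simp add: \<delta>_def)
  define b where "b k = (LBINT z:cylinder \<infinity>. F (w z) * \<psi> k z) + \<delta>" for k
  define x where "x k = \<mu> (C2 * \<delta> * R (Suc k) powr - \<kappa>)" for k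
  have "summable x"
  proof (rule summable_of_superlinear_growth[OF \<open>1 < p_c\<close> C1])
    have "0 \<le> (LBINT z:cylinder \<infinity>. F (w z) * \<psi> 0 z)"
      unfolding set_lebesgue_integral_def using F_nonneg \<psi>_range
      by (intro Bochner_Integration.integral_nonneg) simp
    then show "0 < b 0" using \<delta> by (simp add: b_def)
    show "b k \<le> b (Suc k)" for k
      unfolding b_def
      by (intro add_right_mono set_integral_mono \<psi>_int mult_left_mono \<psi>_mono F_nonneg)
    show "0 \<le> x k" for k using C2 \<delta> by (auto simp: x_def intro!: assms(6))
    fix k
    have "\<delta> \<le> data (R (Suc k))" using k0[of "Suc k + k0"] by (simp add: \<delta>_def R_def)
    note e = est[OF R1 \<delta> identity[unfolded \<psi>_def] this, folded \<psi>_def \<theta>_def]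
    then have \<theta>_int: "set_integrable lborel (cylinder \<infinity>) (\<lambda>z. F (w z) * \<theta> (Suc k) z)" by blast
    have "C1 * b (Suc k) powr p_c * x k \<le> (LBINT z:cylinder \<infinity>. F (w z) * \<theta> (Suc k) z)"
      using e by (simp add: b_def x_def)
    moreover have "(LBINT z:cylinder \<infinity>. F (w z) * \<theta> (Suc k) z) \<le> (LBINT z:cylinder \<infinity>. F (w z) * \<psi> (Suc k) z)"
      by (intro set_integral_mono \<psi>_int \<theta>_int mult_left_mono \<theta>_le F_nonneg)
    moreover have "(LBINT z:cylinder \<infinity>. F (w z) * \<theta> (Suc k) z) + (LBINT z:cylinder \<infinity>. F (w z) * \<psi> k z)
        \<le> (LBINT z:cylinder \<infinity>. F (w z) * \<psi> (Suc (Suc k)) z)"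
    proof (subst set_integral_add(2)[OF \<theta>_int \<psi>_int, symmetric], rule set_integral_mono)
      show "F (w z) * \<theta> (Suc k) z + F (w z) * \<psi> k z \<le> F (w z) * \<psi> (Suc (Suc k)) z" for z
        using mult_left_mono[OF \<theta>_gap F_nonneg] by (simp add: distrib_left)
    qed (intro set_integral_add(1) \<theta>_int \<psi>_int)+
    ultimately show "C1 * b (Suc k) powr p_c * x k \<le> min (b (Suc k)) (b (Suc (Suc k)) - b k)"
      using \<delta> by (simp add: b_def)
  qed
  define q where "q = r powr - \<kappa>"
  \<comment> \<open>\<open>Suc k0\<close> absorbs both the shift in \<open>R\<close> and the index
    \<open>Suc k\<close> in \<open>x\<close>, whose terms belong to the scale of
    \<open>b (Suc k)\<close>.\<close>
  define a where "a = C2 * \<delta> * q ^ Suc k0"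
  have q: "0 < q" "q < 1" using r \<kappa> by (auto simp: q_def powr_less_one)
  have "x k = \<mu> (a * q ^ k)" for k
  proof -
    have "(r ^ i) powr - \<kappa> = q ^ i" for i
      by (induction i) (use r in \<open>auto simp: q_def powr_mult\<close>)
    then have "R (Suc k) powr - \<kappa> = q ^ (Suc k + k0)" by (simp only: R_def)
    then show ?thesis by (simp add: x_def a_def power_add algebra_simps)
  qed
  then have "summable (\<lambda>k. \<mu> (a * q ^ k))" using \<open>summable x\<close> by presburger
  moreover have "0 < a" using C2 \<delta> q by (simp add: a_def)
  ultimately show ?thesis using dini_integral_finite[OF assms(7,6) _ q] by blast
qed

end
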